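(* Let $p\in(1,\infty)$ and $\alpha\in(0,\infty)$. Then $$K\big(f,t^{\frac\alpha p};L^p,S^p(t^{-\alpha})\big)\approx\left(\int_0^t(f^{**}(s)-f^*(s))^p\,ds\right)^{\frac1p}+t^{\frac\alpha p}\left(\int_t^\infty(f^{**}(s)-f^*(s))^p\,s^{-\alpha}\,ds\right)^{\frac1p}$$ for all $f\in L^p+S^p(t^{-\alpha})$ and all $t\in(0,\infty)$, with constants of equivalence independent of $f$ and $t$.
   Context: $(\mathcal R,\mu)$ is a nonatomic $\sigma$-finite measure space with $\mu(\mathcal R)\in(0,\infty]$, and all function spaces are over $(\mathcal R,\mu)$; $L^p=L^p(\mathcal R,\mu)$ is the Lebesgue space. The non-increasing rearrangement of a measurable $f$ is $f^*(t)=\inf\{\lambda\ge0:\mu(\{|f|>\lambda\})\le t\}$, and $f^{**}(t)=\frac1t\int_0^tf^*(s)\,ds$. $S^p(t^{-\alpha})$ is the set of measurable $f$ on $\mathcal R$ with $\lim_{t\to\infty}f^*(t)=0$ and $\|f\|_{S^p(t^{-\alpha})}=\left(\int_0^\infty(f^{**}(t)-f^*(t))^p\,t^{-\alpha}\,dt\right)^{1/p}<\infty$. $X_0+X_1$ is the set of $f$ that can be written as $f=f_0+f_1$ with $f_i\in X_i$, and $K(f,t;X_0,X_1)=\inf\{\|f_0\|_{X_0}+t\|f_1\|_{X_1}: f=f_0+f_1,\ f_i\in X_i\}$. The relation $\approx$ means that each side is bounded by a constant multiple of the other. *)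

theory Defs
  imports "HOL-Analysis.Analysis"
begin

definition atom_of :: "'a measure \<Rightarrow> 'a set \<Rightarrow> bool" where
  "atom_of M A \<longleftrightarrow> A \<in> sets M \<and> emeasure M A > 0 \<and>
     (\<forall>B\<in>sets M. B \<subseteq> A \<longrightarrow> emeasure M B = 0 \<or> emeasure M B = emeasure M A)"

definition nonatomic :: "'a measure \<Rightarrow> bool" where
  "nonatomic M \<longleftrightarrow> (\<nexists>A. atom_of M A)"

text \<open>The power \<open>x\<^sup>a\<close> on \<open>[0,\<infinity>]\<close>, meant for exponents \<open>a > 0\<close> only.\<close>
definition epowr :: "ennreal \<Rightarrow> real \<Rightarrow> ennreal" where
  "epowr x a = (if x = \<infinity> then \<infinity> else ennreal (enn2real x powr a))"

text \<open>The non-increasing rearrangement \<open>f\<^sup>*\<close> and its average \<open>f\<^sup>*\<^sup>*\<close>, with values in \<open>[0,\<infinity>]\<close>.\<close>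
definition rearr :: "'a measure \<Rightarrow> ('a \<Rightarrow> 'b::real_normed_vector) \<Rightarrow> real \<Rightarrow> ennreal" where
  "rearr M f t =
     Inf {ennreal l |l. l \<ge> 0 \<and> emeasure M {x \<in> space M. norm (f x) > l} \<le> ennreal t}"

definition avg_rearr :: "'a measure \<Rightarrow> ('a \<Rightarrow> 'b::real_normed_vector) \<Rightarrow> real \<Rightarrow> ennreal" where
  "avg_rearr M f t = (\<integral>\<^sup>+ s\<in>{0<..<t}. rearr M f s \<partial>lborel) / ennreal t"

text \<open>
  The oscillation \<open>f\<^sup>*\<^sup>* - f\<^sup>*\<close>. The convention \<open>\<infinity> - \<infinity> = \<infinity>\<close> of \<^typ>\<open>ennreal\<close> plays no role below:
  a function with values in a normed space and \<open>f\<^sup>*(t) \<rightarrow> 0\<close> has \<open>f\<^sup>* < \<infinity>\<close> on \<open>(0,\<infinity>)\<close>.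
\<close>
definition osc_rearr :: "'a measure \<Rightarrow> ('a \<Rightarrow> 'b::real_normed_vector) \<Rightarrow> real \<Rightarrow> ennreal" where
  "osc_rearr M f t = avg_rearr M f t - rearr M f t"

definition Lp_norm :: "'a measure \<Rightarrow> real \<Rightarrow> ('a \<Rightarrow> 'b::real_normed_vector) \<Rightarrow> ennreal" where
  "Lp_norm M p f = epowr (\<integral>\<^sup>+ x. ennreal (norm (f x) powr p) \<partial>M) (1 / p)"

definition Lp_space :: "'a measure \<Rightarrow> real \<Rightarrow> ('a \<Rightarrow> 'b::real_normed_vector) set" where
  "Lp_space M p = {f \<in> borel_measurable M. Lp_norm M p f < \<infinity>}"

text \<open>The functional and the space \<open>S\<^sup>p(t\<^sup>-\<^sup>\<alpha>)\<close>.\<close>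
definition Sp_norm :: "'a measure \<Rightarrow> real \<Rightarrow> real \<Rightarrow> ('a \<Rightarrow> 'b::real_normed_vector) \<Rightarrow> ennreal" where
  "Sp_norm M p \<alpha> f =
     epowr (\<integral>\<^sup>+ t\<in>{0<..}. (epowr (osc_rearr M f t) p * ennreal (t powr (-\<alpha>))) \<partial>lborel) (1 / p)"

definition Sp_space :: "'a measure \<Rightarrow> real \<Rightarrow> real \<Rightarrow> ('a \<Rightarrow> 'b::real_normed_vector) set" where
  "Sp_space M p \<alpha> =
     {f \<in> borel_measurable M. (rearr M f \<longlongrightarrow> 0) at_top \<and> Sp_norm M p \<alpha> f < \<infinity>}"

text \<open>
  Functions are identified when they agree almost everywhere. Measurability of \<open>f\<close> is
  demanded separately because the measure need not be complete.
\<close>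
definition sum_space ::
    "'a measure \<Rightarrow> ('a \<Rightarrow> 'b::real_normed_vector) set \<Rightarrow> ('a \<Rightarrow> 'b) set \<Rightarrow> ('a \<Rightarrow> 'b) set" where
  "sum_space M X0 X1 =
     {f \<in> borel_measurable M. \<exists>f0\<in>X0. \<exists>f1\<in>X1. AE x in M. f x = f0 x + f1 x}"

definition K_functional ::
    "'a measure \<Rightarrow> ('a \<Rightarrow> 'b::real_normed_vector) set \<Rightarrow> (('a \<Rightarrow> 'b) \<Rightarrow> ennreal) \<Rightarrow>
     ('a \<Rightarrow> 'b) set \<Rightarrow> (('a \<Rightarrow> 'b) \<Rightarrow> ennreal) \<Rightarrow> ('a \<Rightarrow> 'b) \<Rightarrow> real \<Rightarrow> ennreal" where
  "K_functional M X0 N0 X1 N1 f t =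
     Inf {N0 f0 + ennreal t * N1 f1 |f0 f1. f0 \<in> X0 \<and> f1 \<in> X1 \<and> (AE x in M. f x = f0 x + f1 x)}"

end

theory Submission
  imports Defs
begin

text \<open>
  For non-increasing finite \<open>h = f\<^sup>*\<close> one has \<open>t (f\<^sup>*\<^sup>* - f\<^sup>*)(t) = \<integral>\<^sub>0\<^sup>t (h(s) - h(t)) ds\<close>. This gives,
  for \<open>f = f\<^sub>0 + f\<^sub>1\<close>, the substitute
  \<open>(f\<^sup>*\<^sup>* - f\<^sup>*)(s) \<le> 2 f\<^sub>0\<^sup>*\<^sup>*(s) + 2 (f\<^sub>1\<^sup>*\<^sup>* - f\<^sub>1\<^sup>*)(2s)\<close>
  for the missing subadditivity, and Hardy's inequality yields the lower bound of the K-functional.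
  For the upper bound, \<open>f\<^sub>1\<close> is the truncation of \<open>f\<close> at the level \<open>f\<^sup>*(t)\<close>: its
  oscillation vanishes on \<open>(0,t]\<close> and is dominated by that of \<open>f\<close> beyond, while the excess
  \<open>g = (f\<^sup>* - f\<^sup>*(t))\<^sub>+\<close> satisfies \<open>g(s) \<le> g(2s) + 2 (f\<^sup>*\<^sup>* - f\<^sup>*)(2s)\<close>, which bounds
  its \<open>L\<^sup>p\<close> norm by that of \<open>f\<^sup>*\<^sup>* - f\<^sup>*\<close> on \<open>(0,2t)\<close>.
\<close>

section \<open>Powers of extended nonnegative reals\<close>

lemma epowr_ennreal: "0 \<le> x \<Longrightarrow> epowr (ennreal x) p = ennreal (x powr p)"
  by (simp add: epowr_def)

lemma epowr_top [simp]: "epowr top p = top"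
  by (simp add: epowr_def)

lemma epowr_zero [simp]: "epowr 0 p = 0"
  by (simp add: epowr_def)

lemma epowr_one [simp]: "epowr x 1 = x"
  by (cases x) (auto simp: epowr_ennreal)

lemma epowr_mono: "0 \<le> p \<Longrightarrow> x \<le> y \<Longrightarrow> epowr x p \<le> epowr y p"
  by (cases x; cases y) (auto simp: epowr_ennreal powr_mono2 top_unique)

lemma epowr_epowr_inverse [simp]: "0 < p \<Longrightarrow> epowr (epowr x p) (1 / p) = x"
  by (cases x) (auto simp: epowr_ennreal powr_powr)

lemma epowr_inverse_epowr [simp]: "0 < p \<Longrightarrow> epowr (epowr x (1 / p)) p = x"
  using epowr_epowr_inverse[of "1 / p" x] by simp

lemma epowr_le_iff: "0 < p \<Longrightarrow> epowr x p \<le> y \<longleftrightarrow> x \<le> epowr y (1 / p)"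
  by (metis epowr_epowr_inverse epowr_inverse_epowr epowr_mono less_imp_le zero_less_divide_1_iff)

lemma epowr_less_top_iff [simp]: "epowr x p < top \<longleftrightarrow> x < top"
  by (cases x) (auto simp: epowr_ennreal)

lemma epowr_mult: "0 < p \<Longrightarrow> epowr (x * y) p = epowr x p * epowr y p"
  by (cases x; cases y)
    (auto simp: epowr_ennreal powr_mult ennreal_mult_top ennreal_top_mult simp flip: ennreal_mult)

text \<open>For p > 0 the power is an order isomorphism of [0,\<infinity>] with inverse exponent
  1/p, so it preserves suprema.\<close>

lemma epowr_SUP: "0 < p \<Longrightarrow> epowr (SUP i\<in>I. u i) p = (SUP i\<in>I. epowr (u i) p)"
proof (rule antisym)
  assume p: "0 < p"
  show "epowr (SUP i\<in>I. u i) p \<le> (SUP i\<in>I. epowr (u i) p)"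
    unfolding epowr_le_iff[OF p] by (intro SUP_least) (auto simp flip: epowr_le_iff[OF p] intro: SUP_upper)
  show "(SUP i\<in>I. epowr (u i) p) \<le> epowr (SUP i\<in>I. u i) p"
    using p by (auto intro!: SUP_least epowr_mono SUP_upper)
qed

lemma borel_measurable_epowr [measurable]:
  assumes [measurable]: "u \<in> borel_measurable N"
  shows "(\<lambda>x. epowr (u x) p) \<in> borel_measurable N"
  unfolding epowr_def by measurable

text \<open>Bounding x + y by twice the maximum gives one inequality for all positive exponents; it
  is applied with p and with 1/p.\<close>

lemma epowr_add_le:
  assumes "0 < q"
  shows "epowr (x + y) q \<le> ennreal (2 powr q) * (epowr x q + epowr y q)"
proof -
  have "epowr (x + y) q \<le> epowr (2 * max x y) q"
    using assms by (intro epowr_mono) (auto simp: mult_2 intro!: add_mono)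
  also have "\<dots> = ennreal (2 powr q) * epowr (max x y) q"
    using assms by (simp add: epowr_mult epowr_ennreal flip: ennreal_numeral)
  also have "\<dots> \<le> ennreal (2 powr q) * (epowr x q + epowr y q)"
    by (intro mult_left_mono) (auto simp: max_def intro: order_trans add_increasing add_increasing2)
  finally show ?thesis .
qed

text \<open>
  The loss factor \<open>c\<close> in front of the first summand may be taken arbitrarily close to \<open>1\<close>, so that
  this term can be absorbed in the two dilation arguments below.
\<close>
lemma epowr_add_le_absorb:
  assumes "0 < p" "1 < c"
  obtains C :: real where "0 < C"
    "\<And>x y. epowr (x + y) p \<le> ennreal c * epowr x p + ennreal C * epowr y p"
proof -
  \<comment> \<open>The split is at y = d * x. Below it the sum is at most (1 + d) * x, whose p-th
    power costs exactly the factor c; above it x < y / d, and the y term carries everything.\<close>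
  define d where "d = c powr (1 / p) - 1"
  have d: "0 < d" "(1 + d) powr p = c"
    using assms by (auto simp: d_def powr_powr)
  define C where "C = (1 / d + 1) powr p"
  have C: "0 < C"
    using d by (simp add: C_def add_pos_pos less_imp_neq[symmetric])
  have "epowr (x + y) p \<le> ennreal c * epowr x p + ennreal C * epowr y p" for x y
  proof (cases x; cases y)
    fix a b assume ab: "0 \<le> a" "x = ennreal a" "0 \<le> b" "y = ennreal b"
    have "(a + b) powr p \<le> c * a powr p + C * b powr p"
    proof (cases "b \<le> d * a")
      case True
      have "(a + b) powr p \<le> ((1 + d) * a) powr p"
        using True ab assms by (intro powr_mono2) (auto simp: algebra_simps)
      also have "\<dots> = c * a powr p"
        using ab d by (simp add: powr_mult)
      finally show ?thesis
        using C by (smt (verit) mult_nonneg_nonneg powr_ge_zero)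
    next
      case False
      have "(a + b) powr p \<le> ((1 / d + 1) * b) powr p"
        using False ab assms d by (intro powr_mono2) (auto simp: algebra_simps pos_le_divide_eq)
      also have "\<dots> = C * b powr p"
        using ab d by (simp add: powr_mult C_def)
      finally show ?thesis
        using assms by (smt (verit) mult_nonneg_nonneg powr_ge_zero)
    qed
    then show ?thesis
      using ab assms C
      by (simp add: epowr_ennreal flip: ennreal_plus ennreal_mult)
  qed (use assms C in \<open>auto simp: ennreal_mult_top\<close>)
  with C show ?thesis by (rule that)
qed

text \<open>Moving q * A to the left is legitimate only for finite A. Each use therefore first cuts
  the integral off, with constants that do not depend on the cut.\<close>

lemma ennreal_absorb:
  fixes A B :: ennreal
  assumes "A < top" "0 \<le> q" "q < 1" "A \<le> ennreal q * A + B"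
  shows "A \<le> ennreal (1 / (1 - q)) * B"
proof (cases A; cases B)
  fix a b assume ab: "0 \<le> a" "A = ennreal a" "0 \<le> b" "B = ennreal b"
  have "a \<le> q * a + b"
    using assms ab by (simp flip: ennreal_plus ennreal_mult)
  then have "a \<le> 1 / (1 - q) * b"
    using assms by (simp add: field_simps)
  then show ?thesis
    using ab assms by (simp flip: ennreal_mult)
qed (use assms in \<open>auto simp: ennreal_mult_top\<close>)

text \<open>Suited to rearrangements, which are accessible through their finite upper
  bounds.\<close>

lemma ennreal_eqI_le_real:
  fixes x y :: ennreal
  assumes "\<And>l. 0 \<le> l \<Longrightarrow> x \<le> ennreal l \<longleftrightarrow> y \<le> ennreal l"
  shows "x = y"
  using assms by (cases x; cases y) (auto simp: top_unique intro!: antisym)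

section \<open>Integrals of monotone functions\<close>

lemma borel_measurable_antimono_ennreal:
  fixes h :: "real \<Rightarrow> ennreal"
  assumes "antimono h"
  shows "h \<in> borel_measurable borel"
proof (rule borel_measurableI_greater)
  fix a
  have "is_interval {x. a < h x}"
    unfolding is_interval_1 using antimonoD[OF assms] by (metis mem_Collect_eq order.strict_trans2)
  then show "{x \<in> space borel. a < h x} \<in> sets borel"
    by (simp add: real_interval_borel_measurable)
qed

lemma borel_measurable_mono_ennreal:
  fixes h :: "real \<Rightarrow> ennreal"
  assumes "mono h"
  shows "h \<in> borel_measurable borel"
proof (rule borel_measurableI_greater)
  fix a
  have "is_interval {x. a < h x}"
    unfolding is_interval_1 using monoD[OF assms] by (metis mem_Collect_eq order.strict_trans2)
  then show "{x \<in> space borel. a < h x} \<in> sets borel"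
    by (simp add: real_interval_borel_measurable)
qed

text \<open>A value of [0,\<infinity>] becomes the length of the interval below it, which is the
  starting point of the layer-cake formula.\<close>

lemma emeasure_ennreal_less: "emeasure lborel {s. 0 < s \<and> ennreal s < a} = a"
proof (cases a)
  case (real r)
  then have "{s. 0 < s \<and> ennreal s < a} = {0<..<r}"
    by (auto simp: ennreal_less_iff)
  then show ?thesis using real by simp
next
  case top
  have "of_nat n \<le> emeasure lborel {s. 0 < s \<and> ennreal s < a}" for n
  proof -
    have "of_nat n = emeasure lborel {0<..<real n}"
      by (simp add: ennreal_of_nat_eq_real_of_nat)
    also have "\<dots> \<le> emeasure lborel {s. 0 < s \<and> ennreal s < a}"
      using top by (intro emeasure_mono) auto
    finally show ?thesis .
  qed
  then have "(SUP n. of_nat n) \<le> emeasure lborel {s. 0 < s \<and> ennreal s < a}"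
    by (rule SUP_least)
  then show ?thesis
    using top by (simp add: ennreal_SUP_of_nat_eq_top top_unique)
qed

text \<open>Tonelli's theorem for the region under the graph of u.\<close>

lemma nn_integral_layer_cake:
  assumes "sigma_finite_measure N" and [measurable]: "u \<in> borel_measurable N"
  shows "(\<integral>\<^sup>+x. u x \<partial>N) = (\<integral>\<^sup>+l\<in>{0<..}. emeasure N {x \<in> space N. ennreal l < u x} \<partial>lborel)"
proof -
  interpret N: sigma_finite_measure N by fact
  interpret pair_sigma_finite N lborel ..
  have "(\<integral>\<^sup>+x. u x \<partial>N) = (\<integral>\<^sup>+x. emeasure lborel {l. 0 < l \<and> ennreal l < u x} \<partial>N)"
    by (simp add: emeasure_ennreal_less)
  also have "\<dots> = (\<integral>\<^sup>+x. (\<integral>\<^sup>+l. indicator {l. 0 < l \<and> ennreal l < u x} l \<partial>lborel) \<partial>N)"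
    by simp
  also have "\<dots> = (\<integral>\<^sup>+l. (\<integral>\<^sup>+x. indicator {l. 0 < l \<and> ennreal l < u x} l \<partial>N) \<partial>lborel)"
    by (rule Fubini'[symmetric]) (simp add: indicator_def)
  also have "\<dots> = (\<integral>\<^sup>+l. (\<integral>\<^sup>+x. indicator {x \<in> space N. ennreal l < u x} x * indicator {0<..} l \<partial>N) \<partial>lborel)"
    by (intro nn_integral_cong) (auto simp: indicator_def)
  also have "\<dots> = (\<integral>\<^sup>+l\<in>{0<..}. emeasure N {x \<in> space N. ennreal l < u x} \<partial>lborel)"
    by (simp add: nn_integral_multc)
  finally show ?thesis .
qed

lemma nn_integral_dilation:
  fixes u :: "real \<Rightarrow> ennreal" and c :: real
  assumes "u \<in> borel_measurable borel" "0 < c"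
  shows "(\<integral>\<^sup>+s. u (c * s) \<partial>lborel) = ennreal (1 / c) * (\<integral>\<^sup>+s. u s \<partial>lborel)"
  using nn_integral_real_affine[OF assms(1), of c 0] assms(2)
  by (simp flip: ennreal_mult mult.assoc)

section \<open>Averages of non-increasing functions\<close>

definition mean :: "(real \<Rightarrow> ennreal) \<Rightarrow> real \<Rightarrow> ennreal" where
  "mean h t = (\<integral>\<^sup>+s\<in>{0<..<t}. h s \<partial>lborel) / ennreal t"

text \<open>The integral is monotone in its upper limit, whatever h is.\<close>

lemma borel_measurable_mean [measurable]: "mean h \<in> borel_measurable borel"
proof -
  have [measurable]: "(\<lambda>t. \<integral>\<^sup>+s\<in>{0<..<t}. h s \<partial>lborel) \<in> borel_measurable borel"
    by (intro borel_measurable_mono_ennreal monoI nn_set_integral_set_mono) auto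
  show ?thesis
    unfolding mean_def by measurable
qed

lemma mean_le:
  assumes "\<And>s. 0 < s \<Longrightarrow> s < t \<Longrightarrow> h s \<le> c" "0 < t"
  shows "mean h t \<le> c"
proof -
  have "(\<integral>\<^sup>+s\<in>{0<..<t}. h s \<partial>lborel) \<le> (\<integral>\<^sup>+s\<in>{0<..<t}. c \<partial>lborel)"
    using assms by (intro nn_integral_mono) (auto simp: indicator_def)
  also have "\<dots> = c * ennreal t"
    using assms by (simp add: nn_integral_cmult_indicator)
  finally show ?thesis
    using assms unfolding mean_def by (intro divide_le_posI_ennreal) (auto simp: mult.commute)
qed

lemma mean_ge:
  assumes "\<And>s. 0 < s \<Longrightarrow> s < t \<Longrightarrow> c \<le> h s" "0 < t"
  shows "c \<le> mean h t"
proof -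
  have "c * ennreal t = (\<integral>\<^sup>+s\<in>{0<..<t}. c \<partial>lborel)"
    using assms by (simp add: nn_integral_cmult_indicator)
  also have "\<dots> \<le> (\<integral>\<^sup>+s\<in>{0<..<t}. h s \<partial>lborel)"
    using assms by (intro nn_integral_mono) (auto simp: indicator_def)
  finally have "c * ennreal t / ennreal t \<le> mean h t"
    unfolding mean_def by (rule divide_right_mono_ennreal)
  then show ?thesis
    using assms by (simp add: mult_divide_eq_ennreal)
qed

lemma mult_mean: "0 < t \<Longrightarrow> ennreal t * mean h t = (\<integral>\<^sup>+s\<in>{0<..<t}. h s \<partial>lborel)"
  by (simp add: mean_def ennreal_times_divide mult.commute[of "ennreal t"] mult_divide_eq_ennreal)

lemma mult_mean_mono: "0 < s \<Longrightarrow> s \<le> t \<Longrightarrow> ennreal s * mean h s \<le> ennreal t * mean h t"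
  by (auto simp: mult_mean intro!: nn_set_integral_set_mono)

text \<open>On [s, 2s) the function is at most h(s), so passing from (0, s) to (0, 2s) adds at most
  s * h(s) to the integral.\<close>

lemma mean_double_le:
  assumes "antimono h" "0 < s"
  shows "mean h (2 * s) \<le> ennreal (1 / 2) * (mean h s + h s)"
proof -
  have [measurable]: "h \<in> borel_measurable borel"
    using assms by (simp add: borel_measurable_antimono_ennreal)
  define A where "A = (\<integral>\<^sup>+u\<in>{0<..<s}. h u \<partial>lborel)"
  have "(\<integral>\<^sup>+u\<in>{0<..<2 * s}. h u \<partial>lborel)
      \<le> (\<integral>\<^sup>+u. h u * indicator {0<..<s} u + h s * indicator {s..<2 * s} u \<partial>lborel)"
    using assms by (intro nn_integral_mono) (auto simp: indicator_def antimonoD)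
  also have "\<dots> = A + h s * ennreal s"
    using assms by (simp add: A_def nn_integral_add nn_integral_cmult_indicator)
  finally have "mean h (2 * s) \<le> (A + h s * ennreal s) / ennreal (2 * s)"
    unfolding mean_def by (rule divide_right_mono_ennreal)
  also have "\<dots> = ennreal (1 / 2) * (A / ennreal s + h s)"
  proof (cases A; cases "h s")
    fix a b assume ab: "0 \<le> a" "A = ennreal a" "0 \<le> b" "h s = ennreal b"
    have "(A + h s * ennreal s) / ennreal (2 * s) = ennreal ((a + b * s) / (2 * s))"
      using assms ab by (simp add: divide_ennreal flip: ennreal_mult ennreal_plus)
    also have "(a + b * s) / (2 * s) = 1 / 2 * (a / s + b)"
      using assms by (simp add: field_simps)
    also have "ennreal \<dots> = ennreal (1 / 2) * (A / ennreal s + h s)"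
      using assms ab by (simp only: divide_ennreal ennreal_mult' ennreal_plus divide_nonneg_pos)
    finally show ?thesis .
  qed (use assms in \<open>auto simp: ennreal_top_divide ennreal_top_mult ennreal_mult_top\<close>)
  finally show ?thesis
    by (simp add: A_def mean_def)
qed

text \<open>Monotone convergence for the truncations of h at height n. It reduces Hardy's inequality
  to bounded h, for which absorption is possible.\<close>

lemma mean_eq_SUP:
  assumes [measurable]: "h \<in> borel_measurable borel"
  shows "mean h s = (SUP n. mean (\<lambda>u. inf (h u) (of_nat n)) s)"
proof -
  have "(\<integral>\<^sup>+u\<in>{0<..<s}. h u \<partial>lborel)
      = (\<integral>\<^sup>+u. (SUP n. inf (h u) (of_nat n) * indicator {0<..<s} u) \<partial>lborel)"
    by (simp add: SUP_mult_right_ennreal[symmetric] inf_SUP[symmetric] ennreal_SUP_of_nat_eq_top)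
  also have "\<dots> = (SUP n. \<integral>\<^sup>+u\<in>{0<..<s}. inf (h u) (of_nat n) \<partial>lborel)"
    by (intro nn_integral_monotone_convergence_SUP incseq_SucI le_funI mult_right_mono inf_mono) auto
  finally show ?thesis
    by (simp add: mean_def SUP_divide_ennreal)
qed

text \<open>
  The estimate \<open>2 m(2s) \<le> m(s) + h(s)\<close> for
  the average \<open>m\<close> of \<open>h\<close> and a dilation bound the \<open>p\<close>-th power integral of \<open>m\<close>
  by a multiple of itself with a factor below \<open>1\<close>, since \<open>p > 1\<close>.
\<close>
lemma hardy_antimono:
  assumes "1 < p"
  obtains C :: real where "0 < C"
    "\<And>h. antimono h \<Longrightarrow>
      (\<integral>\<^sup>+s\<in>{0<..}. epowr (mean h s) p \<partial>lborel) \<le> ennreal C * (\<integral>\<^sup>+s\<in>{0<..}. epowr (h s) p \<partial>lborel)"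
proof -
  \<comment> \<open>Halving and dilation together yield 2 * (1/2)^p = 2^(1-p) < 1. The loss c spends
    half of this exponent, leaving the absorption factor q = 2^((1-p)/2) < 1.\<close>
  define c where "c = 2 powr ((p - 1) / 2)"
  define q where "q = 2 powr ((1 - p) / 2)"
  have c: "1 < c" using assms by (simp add: c_def)
  have q: "0 < q" "q < 1" using assms by (auto simp: q_def powr_less_one)
  have qc: "2 * (1 / 2) powr p * c = q"
  proof -
    have "2 * (1 / 2) powr p * c = 2 powr (1 - p + (p - 1) / 2)"
      unfolding c_def by (simp add: powr_diff powr_add powr_divide)
    also have "1 - p + (p - 1) / 2 = (1 - p) / 2" by (simp add: field_simps)
    finally show ?thesis by (simp add: q_def)
  qed
  obtain C1 where C1: "0 < C1"
    "\<And>x y. epowr (x + y) p \<le> ennreal c * epowr x p + ennreal C1 * epowr y p"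
    using epowr_add_le_absorb[of p c] c assms by auto
  define C2 where "C2 = 2 * (1 / 2) powr p * C1"
  have C2: "0 < C2" using C1 by (simp add: C2_def)
  \<comment> \<open>A bounded h on a bounded interval makes the left side finite. The resulting
    bound involves neither n nor T, so both cuts can be removed afterwards.\<close>
  have bounded: "(\<integral>\<^sup>+s\<in>{0<..<T}. epowr (mean h s) p \<partial>lborel)
      \<le> ennreal (1 / (1 - q)) * (ennreal C2 * (\<integral>\<^sup>+s\<in>{0<..}. epowr (h s) p \<partial>lborel))"
    if h: "antimono h" "\<And>s. h s \<le> of_nat n" and T: "0 \<le> T" for h :: "real \<Rightarrow> ennreal" and n :: nat and T
  proof (rule ennreal_absorb)
    have [measurable]: "h \<in> borel_measurable borel"
      using h by (simp add: borel_measurable_antimono_ennreal)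
    have "(\<integral>\<^sup>+s\<in>{0<..<T}. epowr (mean h s) p \<partial>lborel) \<le> (\<integral>\<^sup>+s\<in>{0<..<T}. epowr (of_nat n) p \<partial>lborel)"
      using h assms
      by (intro nn_integral_mono) (auto simp: indicator_def intro!: epowr_mono mean_le)
    also have "\<dots> = epowr (of_nat n) p * ennreal T"
      using T by (simp add: nn_integral_cmult_indicator)
    also have "\<dots> < top"
      by (simp add: ennreal_mult_less_top of_nat_less_top)
    finally show "(\<integral>\<^sup>+s\<in>{0<..<T}. epowr (mean h s) p \<partial>lborel) < top" .
    \<comment> \<open>The condition 2s < T implies s < T, so after dilation the same truncated
      integral reappears on the right and can be absorbed.\<close>
    have pt: "epowr (mean h (2 * s)) p * indicator {0<..<T} (2 * s)
      \<le> ennreal ((1 / 2) powr p) * (ennreal c * (epowr (mean h s) p * indicator {0<..<T} s)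
          + ennreal C1 * (epowr (h s) p * indicator {0<..} s))" for s
    proof (cases "0 < s \<and> 2 * s < T")
      case True
      have "epowr (mean h (2 * s)) p \<le> epowr (ennreal (1 / 2) * (mean h s + h s)) p"
        using h True assms by (intro epowr_mono mean_double_le) auto
      also have "\<dots> = ennreal ((1 / 2) powr p) * epowr (mean h s + h s) p"
        using assms by (simp only: epowr_mult epowr_ennreal)
      also have "\<dots> \<le> ennreal ((1 / 2) powr p) * (ennreal c * epowr (mean h s) p + ennreal C1 * epowr (h s) p)"
        by (intro mult_left_mono C1) auto
      finally show ?thesis
        using True by simp
    qed (auto simp: indicator_def)
    have "(\<integral>\<^sup>+s\<in>{0<..<T}. epowr (mean h s) p \<partial>lborel)
        = 2 * (\<integral>\<^sup>+s. epowr (mean h (2 * s)) p * indicator {0<..<T} (2 * s) \<partial>lborel)"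
      using nn_integral_real_affine[of "\<lambda>s. epowr (mean h s) p * indicator {0<..<T} s" 2 0] by simp
    also have "\<dots> \<le> 2 * (\<integral>\<^sup>+s. ennreal ((1 / 2) powr p) * (ennreal c * (epowr (mean h s) p * indicator {0<..<T} s)
          + ennreal C1 * (epowr (h s) p * indicator {0<..} s)) \<partial>lborel)"
      by (intro mult_left_mono nn_integral_mono pt) auto
    also have "\<dots> = ennreal 2 * (ennreal ((1 / 2) powr p) * (ennreal c * (\<integral>\<^sup>+s\<in>{0<..<T}. epowr (mean h s) p \<partial>lborel)
          + ennreal C1 * (\<integral>\<^sup>+s\<in>{0<..}. epowr (h s) p \<partial>lborel)))"
      by (simp add: nn_integral_cmult nn_integral_add)
    also have "\<dots> = ennreal q * (\<integral>\<^sup>+s\<in>{0<..<T}. epowr (mean h s) p \<partial>lborel)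
          + ennreal C2 * (\<integral>\<^sup>+s\<in>{0<..}. epowr (h s) p \<partial>lborel)"
      using c C1(1) unfolding qc[symmetric] C2_def by (simp add: ennreal_mult distrib_left mult.assoc)
    finally show "(\<integral>\<^sup>+s\<in>{0<..<T}. epowr (mean h s) p \<partial>lborel)
        \<le> ennreal q * (\<integral>\<^sup>+s\<in>{0<..<T}. epowr (mean h s) p \<partial>lborel)
          + ennreal C2 * (\<integral>\<^sup>+s\<in>{0<..}. epowr (h s) p \<partial>lborel)" .
  qed (use q in auto)
  have "(\<integral>\<^sup>+s\<in>{0<..}. epowr (mean h s) p \<partial>lborel)
      \<le> ennreal (C2 / (1 - q)) * (\<integral>\<^sup>+s\<in>{0<..}. epowr (h s) p \<partial>lborel)" (is "_ \<le> ?R")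
    if h: "antimono h" for h
  proof -
    have [measurable]: "h \<in> borel_measurable borel"
      using h by (simp add: borel_measurable_antimono_ennreal)
    define k where "k n s = inf (h s) (of_nat n)" for n s
    have k: "antimono (k n)" for n
      using h by (auto simp: k_def antimono_def intro: inf.coboundedI1)
    have mono_k: "mean (k n) s \<le> mean (k m) s" if "n \<le> m" for n m s
      unfolding mean_def k_def using that
      by (intro divide_right_mono_ennreal nn_integral_mono mult_right_mono inf_mono) auto
    \<comment> \<open>One index cuts both the height of h and the interval. At a fixed s, any index
      above both n and s recovers the n-th truncated mean, so the supremum over n restores the full
      integrand.\<close>
    define F where "F n s = epowr (mean (k n) s) p * indicator {0<..<real n} s" for n s
    have "incseq F"
      using assms
      by (intro monoI le_funI)
        (auto simp: F_def indicator_def intro!: epowr_mono mono_k)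
    moreover have "F n \<in> borel_measurable lborel" for n
      unfolding F_def by measurable
    ultimately have SUP_F: "(\<integral>\<^sup>+s. (SUP n. F n s) \<partial>lborel) = (SUP n. \<integral>\<^sup>+s. F n s \<partial>lborel)"
      by (intro nn_integral_monotone_convergence_SUP) auto
    have "(\<integral>\<^sup>+s\<in>{0<..}. epowr (mean h s) p \<partial>lborel) \<le> (\<integral>\<^sup>+s. (SUP n. F n s) \<partial>lborel)"
    proof (intro nn_integral_mono)
      fix s :: real
      show "epowr (mean h s) p * indicator {0<..} s \<le> (SUP n. F n s)"
      proof (cases "0 < s")
        case True
        have "epowr (mean h s) p = (SUP n. epowr (mean (k n) s) p)"
          unfolding k_def using assms by (subst mean_eq_SUP) (auto simp: epowr_SUP)
        also have "\<dots> \<le> (SUP n. F n s)"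
        proof (intro SUP_mono)
          fix n
          have "epowr (mean (k n) s) p \<le> F (max n (nat \<lceil>s\<rceil> + 1)) s"
            using True assms by (auto simp: F_def indicator_def intro!: epowr_mono mono_k) linarith+
          then show "\<exists>m\<in>UNIV. epowr (mean (k n) s) p \<le> F m s" by blast
        qed
        finally show ?thesis using True by simp
      qed auto
    qed
    also have "\<dots> \<le> ?R"
      unfolding SUP_F
    proof (rule SUP_least)
      fix n
      have "(\<integral>\<^sup>+s. F n s \<partial>lborel) \<le> ennreal (1 / (1 - q)) * (ennreal C2 * (\<integral>\<^sup>+s\<in>{0<..}. epowr (k n s) p \<partial>lborel))"
        unfolding F_def by (intro bounded[of _ n] k) (auto simp: k_def)
      also have "\<dots> \<le> ennreal (1 / (1 - q)) * (ennreal C2 * (\<integral>\<^sup>+s\<in>{0<..}. epowr (h s) p \<partial>lborel))"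
        using assms
        by (intro mult_left_mono nn_integral_mono mult_right_mono epowr_mono) (auto simp: k_def)
      also have "\<dots> = ?R"
        using q C2 by (simp flip: ennreal_mult mult.assoc)
      finally show "(\<integral>\<^sup>+s. F n s \<partial>lborel) \<le> ?R" .
    qed
    finally show ?thesis .
  qed
  moreover have "0 < C2 / (1 - q)" using q C2 by simp
  ultimately show ?thesis using that by blast
qed

section \<open>Oscillation of non-increasing functions\<close>

definition osc :: "(real \<Rightarrow> ennreal) \<Rightarrow> real \<Rightarrow> ennreal" where
  "osc h t = mean h t - h t"

text \<open>Since h(t) is finite, the constant can be subtracted under the integral. This makes t *
  osc h t the integral of a nonnegative excess, which is what the later comparisons use.\<close>

lemma osc_eq_mean:
  assumes "antimono h" "0 < t" "h t < top"
  shows "osc h t = mean (\<lambda>s. h s - h t) t"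
proof -
  have [measurable]: "h \<in> borel_measurable borel"
    using assms by (simp add: borel_measurable_antimono_ennreal)
  have "(\<integral>\<^sup>+s\<in>{0<..<t}. (h s - h t) \<partial>lborel)
      = (\<integral>\<^sup>+s. h s * indicator {0<..<t} s - h t * indicator {0<..<t} s \<partial>lborel)"
    by (intro nn_integral_cong) (auto simp: indicator_def)
  also have "\<dots> = (\<integral>\<^sup>+s\<in>{0<..<t}. h s \<partial>lborel) - (\<integral>\<^sup>+s\<in>{0<..<t}. h t \<partial>lborel)"
  proof (intro nn_integral_diff)
    show "(\<integral>\<^sup>+s\<in>{0<..<t}. h t \<partial>lborel) \<noteq> \<infinity>"
      using assms by (simp add: nn_integral_cmult_indicator ennreal_mult_eq_top_iff)
    show "AE s in lborel. h t * indicator {0<..<t} s \<le> h s * indicator {0<..<t} s"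
      using assms by (auto simp: indicator_def antimonoD)
  qed measurable
  also have "(\<integral>\<^sup>+s\<in>{0<..<t}. h t \<partial>lborel) = h t * ennreal t"
    using assms by (simp add: nn_integral_cmult_indicator)
  finally show ?thesis
    using assms unfolding mean_def osc_def
    by (cases "\<integral>\<^sup>+s\<in>{0<..<t}. h s \<partial>lborel"; cases "h t")
      (auto simp: divide_ennreal ennreal_top_divide ennreal_minus_if field_simps
         simp flip: ennreal_mult)
qed

text \<open>By monotonicity s * (h(s) - h(2s)) is at most the integral of h - h(2s) over (0, s),
  hence at most the one over (0, 2s), which is 2s * osc h (2s).\<close>

lemma diff_double_le_osc:
  assumes "antimono h" "0 < s" "h (2 * s) < top"
  shows "h s - h (2 * s) \<le> 2 * osc h (2 * s)"
proof -
  let ?k = "\<lambda>u. h u - h (2 * s)"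
  have "ennreal s * ?k s \<le> ennreal s * mean ?k s"
    using assms by (intro mult_left_mono mean_ge ennreal_minus_mono) (auto simp: antimonoD)
  also have "\<dots> \<le> ennreal (2 * s) * mean ?k (2 * s)"
    using assms by (intro mult_mean_mono) auto
  also have "\<dots> = ennreal s * (2 * osc h (2 * s))"
    using assms by (simp add: osc_eq_mean ennreal_mult mult_ac)
  finally show ?thesis
    using assms by (simp add: ennreal_mult_le_mult_iff)
qed

lemma mean_eq_add_osc:
  assumes "antimono h" "0 < t"
  shows "mean h t = h t + osc h t"
  unfolding osc_def using assms by (simp add: add_diff_inverse_ennreal mean_ge antimonoD)

text \<open>Finiteness of h(t) excludes the difference \<open>top - top\<close>, which is
  \<open>top\<close>.\<close>

lemma antimono_diff_eq_0:
  fixes h :: "real \<Rightarrow> ennreal"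
  assumes "antimono h" "t \<le> s" "h t < top"
  shows "h s - h t = 0"
  using antimonoD[OF assms(1,2)] assms(3) by (auto simp: diff_eq_0_iff_ennreal)

text \<open>The excess over h(t) vanishes beyond t, so the integral may run over the whole
  half-line. In that form equimeasurability transfers it to the measure space.\<close>

lemma nn_integral_excess_eq_osc:
  assumes "antimono h" "0 < t" "h t < top"
  shows "(\<integral>\<^sup>+s\<in>{0<..}. (h s - h t) \<partial>lborel) = ennreal t * osc h t"
proof -
  have "(\<integral>\<^sup>+s\<in>{0<..}. (h s - h t) \<partial>lborel) = (\<integral>\<^sup>+s\<in>{0<..<t}. (h s - h t) \<partial>lborel)"
    by (intro nn_integral_cong) (auto simp: indicator_def antimono_diff_eq_0[OF assms(1) _ assms(3)])
  then show ?thesis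
    using assms by (simp add: osc_eq_mean mult_mean)
qed

text \<open>
  The excess \<open>g = h - h(t)\<close> satisfies \<open>g(s) \<le> g(2s) + 2 osc h (2s)\<close>, and dilation by \<open>2\<close> halves
  the integral of the \<open>p\<close>-th power of \<open>g\<close>, which is therefore absorbed. Cutting off a
  neighbourhood of \<open>0\<close> makes that integral finite.
\<close>
lemma nn_integral_excess_powr_le:
  assumes "0 < p"
  obtains C :: real where "0 < C"
    "\<And>h t. antimono h \<Longrightarrow> (\<And>s. 0 < s \<Longrightarrow> h s < top) \<Longrightarrow> 0 < t \<Longrightarrow>
      (\<integral>\<^sup>+s\<in>{0<..}. epowr (h s - h t) p \<partial>lborel)
        \<le> ennreal C * (\<integral>\<^sup>+s\<in>{0<..<2 * t}. epowr (osc h s) p \<partial>lborel)"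
proof -
  \<comment> \<open>Dilation contributes 1/2, so the loss 3/2 leaves the factor 3/4 to be absorbed;
    this is the origin of 4 = 1 / (1 - 3/4) in the final constant.\<close>
  obtain C1 where C1: "0 < C1"
    "\<And>x y. epowr (x + y) p \<le> ennreal (3 / 2) * epowr x p + ennreal C1 * epowr y p"
    using epowr_add_le_absorb[of p "3 / 2"] assms by auto
  define C2 where "C2 = C1 * 2 powr p / 2"
  have C2: "0 < C2" using C1 by (simp add: C2_def)
  have "(\<integral>\<^sup>+s\<in>{0<..}. epowr (h s - h t) p \<partial>lborel)
        \<le> ennreal (4 * C2) * (\<integral>\<^sup>+s\<in>{0<..<2 * t}. epowr (osc h s) p \<partial>lborel)" (is "_ \<le> ?R")
    if h: "antimono h" and fin: "\<And>s. 0 < s \<Longrightarrow> h s < top" and t: "0 < t" for h t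
  proof -
    have [measurable]: "h \<in> borel_measurable borel"
      using h by (simp add: borel_measurable_antimono_ennreal)
    have [measurable]: "osc h \<in> borel_measurable borel"
      unfolding osc_def by measurable
    define g where "g s = h s - h t" for s
    have [measurable]: "g \<in> borel_measurable borel"
      unfolding g_def by measurable
    have g0: "g s = 0" if "t \<le> s" for s
      unfolding g_def using h that fin[OF t] by (rule antimono_diff_eq_0)
    have g_mono: "g s \<le> g r" if "r \<le> s" for r s
      unfolding g_def using that h by (intro ennreal_minus_mono) (auto simp: antimonoD)
    have g_step: "g s \<le> g (2 * s) + 2 * osc h (2 * s)" if "0 < s" for s
    proof -
      have "g s \<le> g (2 * s) + (h s - h (2 * s))"
        using fin[of s] fin[of "2 * s"] fin[of t] that t unfolding g_def
        by (cases "h s"; cases "h (2 * s)"; cases "h t")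
          (auto simp: ennreal_minus_if simp flip: ennreal_plus)
      also have "\<dots> \<le> g (2 * s) + 2 * osc h (2 * s)"
        using h fin[of "2 * s"] that by (intro add_left_mono diff_double_le_osc) auto
      finally show ?thesis .
    qed
    have cut: "(\<integral>\<^sup>+s\<in>{e<..}. epowr (g s) p \<partial>lborel)
        \<le> ennreal (1 / (1 - 3 / 4)) * (ennreal C2 * (\<integral>\<^sup>+s\<in>{0<..<2 * t}. epowr (osc h s) p \<partial>lborel))"
      if e: "0 < e" for e
    proof (rule ennreal_absorb)
      have "(\<integral>\<^sup>+s\<in>{e<..}. epowr (g s) p \<partial>lborel) \<le> (\<integral>\<^sup>+s\<in>{0<..<t}. epowr (g e) p \<partial>lborel)"
        using e g0 assms
        by (intro nn_integral_mono) (auto simp: indicator_def intro!: epowr_mono g_mono)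
      also have "\<dots> = epowr (g e) p * ennreal t"
        using t by (simp add: nn_integral_cmult_indicator)
      also have "\<dots> < top"
        using fin[OF e] by (simp add: ennreal_mult_less_top g_def diff_less_top_ennreal)
      finally show "(\<integral>\<^sup>+s\<in>{e<..}. epowr (g s) p \<partial>lborel) < top" .
      have half: "ennreal a * (ennreal (1 / 2) * x) = ennreal (a * (1 / 2)) * x" for a x
      proof -
        have "ennreal (a * (1 / 2)) = ennreal a * ennreal (1 / 2)"
          by (rule ennreal_mult'') simp
        then show ?thesis by (simp only: mult.assoc)
      qed
      \<comment> \<open>For e < s < t the point 2s lies in (e, 2t): the cut at e survives the
        dilation, while the oscillation is needed up to 2t. For s \<ge> t the excess is 0.\<close>
      have pt: "epowr (g s) p * indicator {e<..} s
          \<le> ennreal (3 / 2) * (epowr (g (2 * s)) p * indicator {e<..} (2 * s))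
            + ennreal (C1 * 2 powr p) * (epowr (osc h (2 * s)) p * indicator {0<..<2 * t} (2 * s))" for s
      proof (cases "e < s \<and> s < t")
        case True
        have "epowr (g s) p \<le> epowr (g (2 * s) + 2 * osc h (2 * s)) p"
          using True e assms by (intro epowr_mono g_step) auto
        also have "\<dots> \<le> ennreal (3 / 2) * epowr (g (2 * s)) p + ennreal C1 * epowr (ennreal 2 * osc h (2 * s)) p"
          using C1 by simp
        also have "ennreal C1 * epowr (ennreal 2 * osc h (2 * s)) p
            = ennreal (C1 * 2 powr p) * epowr (osc h (2 * s)) p"
          using assms C1 by (simp only: epowr_mult epowr_ennreal ennreal_mult'' powr_ge_zero mult.assoc zero_le_numeral)
        finally show ?thesis
          using True e by simp
      qed (auto simp: indicator_def g0)
      have "(\<integral>\<^sup>+s\<in>{e<..}. epowr (g s) p \<partial>lborel)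
          \<le> (\<integral>\<^sup>+s. ennreal (3 / 2) * (epowr (g (2 * s)) p * indicator {e<..} (2 * s))
            + ennreal (C1 * 2 powr p) * (epowr (osc h (2 * s)) p * indicator {0<..<2 * t} (2 * s)) \<partial>lborel)"
        by (intro nn_integral_mono pt)
      also have "\<dots> = ennreal (3 / 2) * (\<integral>\<^sup>+s. epowr (g (2 * s)) p * indicator {e<..} (2 * s) \<partial>lborel)
          + ennreal (C1 * 2 powr p) * (\<integral>\<^sup>+s. epowr (osc h (2 * s)) p * indicator {0<..<2 * t} (2 * s) \<partial>lborel)"
        by (subst nn_integral_add) (simp_all add: nn_integral_cmult)
      also have "\<dots> = ennreal (3 / 2) * (ennreal (1 / 2) * (\<integral>\<^sup>+s\<in>{e<..}. epowr (g s) p \<partial>lborel))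
          + ennreal (C1 * 2 powr p) * (ennreal (1 / 2) * (\<integral>\<^sup>+s\<in>{0<..<2 * t}. epowr (osc h s) p \<partial>lborel))"
        by (subst (1 2) nn_integral_dilation) auto
      also have "\<dots> = ennreal (3 / 2 * (1 / 2)) * (\<integral>\<^sup>+s\<in>{e<..}. epowr (g s) p \<partial>lborel)
          + ennreal (C1 * 2 powr p * (1 / 2)) * (\<integral>\<^sup>+s\<in>{0<..<2 * t}. epowr (osc h s) p \<partial>lborel)"
        by (simp only: half)
      finally show "(\<integral>\<^sup>+s\<in>{e<..}. epowr (g s) p \<partial>lborel)
          \<le> ennreal (3 / 4) * (\<integral>\<^sup>+s\<in>{e<..}. epowr (g s) p \<partial>lborel)
            + ennreal C2 * (\<integral>\<^sup>+s\<in>{0<..<2 * t}. epowr (osc h s) p \<partial>lborel)"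
        by (simp add: C2_def)
    qed auto
    define F where "F n s = epowr (g s) p * indicator {1 / Suc n<..} s" for n s
    have "(\<integral>\<^sup>+s\<in>{0<..}. epowr (g s) p \<partial>lborel) \<le> (\<integral>\<^sup>+s. (SUP n. F n s) \<partial>lborel)"
    proof (intro nn_integral_mono)
      fix s :: real
      show "epowr (g s) p * indicator {0<..} s \<le> (SUP n. F n s)"
      proof (cases "0 < s")
        case True
        then obtain n where "1 / Suc n < s"
          using nat_approx_posE by blast
        then show ?thesis
          using True by (intro SUP_upper2[of n]) (auto simp: F_def)
      qed auto
    qed
    also have "\<dots> = (SUP n. \<integral>\<^sup>+s. F n s \<partial>lborel)"
    proof (intro nn_integral_monotone_convergence_SUP incseq_SucI le_funI)
      fix n s
      have "1 / real (Suc (Suc n)) \<le> 1 / real (Suc n)"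
        by (simp add: frac_le)
      then show "F n s \<le> F (Suc n) s"
        unfolding F_def by (intro mult_left_mono) (auto simp: indicator_def simp del: of_nat_Suc)
    qed (simp add: F_def)
    also have "\<dots> \<le> ?R"
    proof (rule SUP_least)
      fix n
      have "(\<integral>\<^sup>+s. F n s \<partial>lborel)
          \<le> ennreal (1 / (1 - 3 / 4)) * (ennreal C2 * (\<integral>\<^sup>+s\<in>{0<..<2 * t}. epowr (osc h s) p \<partial>lborel))"
        unfolding F_def by (rule cut) simp
      also have "\<dots> = ?R"
        using C2 by (simp add: ennreal_mult mult.assoc)
      finally show "(\<integral>\<^sup>+s. F n s \<partial>lborel) \<le> ?R" .
    qed
    finally show ?thesis
      by (simp add: g_def)
  qed
  moreover have "0 < 4 * C2" using C2 by simp
  ultimately show ?thesis using that by blast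
qed

section \<open>Rearrangements\<close>

text \<open>The distribution function of \<open>norm f\<close>.\<close>

definition tail_measure :: "'a measure \<Rightarrow> ('a \<Rightarrow> 'b::real_normed_vector) \<Rightarrow> real \<Rightarrow> ennreal" where
  "tail_measure M f l = emeasure M {x \<in> space M. l < norm (f x)}"

lemma tail_measure_antimono:
  assumes [measurable]: "f \<in> borel_measurable M" and "k \<le> l"
  shows "tail_measure M f l \<le> tail_measure M f k"
  unfolding tail_measure_def using assms by (intro emeasure_mono) auto

text \<open>The strict superlevel sets increase as the level decreases to l, so continuity of the
  measure from below applies.\<close>

lemma tail_measure_right_continuous:
  assumes [measurable]: "f \<in> borel_measurable M"
  shows "tail_measure M f l = (SUP n. tail_measure M f (l + 1 / Suc n))"
proof -
  have "(SUP n. tail_measure M f (l + 1 / Suc n))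
      = emeasure M (\<Union>n. {x \<in> space M. l + 1 / Suc n < norm (f x)})"
    unfolding tail_measure_def
    by (intro SUP_emeasure_incseq incseq_SucI)
      (auto intro: order.strict_trans1[rotated] simp: frac_le)
  also have "(\<Union>n. {x \<in> space M. l + 1 / Suc n < norm (f x)}) = {x \<in> space M. l < norm (f x)}"
  proof (intro equalityI subsetI)
    fix x assume x: "x \<in> {x \<in> space M. l < norm (f x)}"
    then obtain n where "1 / Suc n < norm (f x) - l"
      using nat_approx_posE[of "norm (f x) - l"] by auto
    with x show "x \<in> (\<Union>n. {x \<in> space M. l + 1 / Suc n < norm (f x)})"
      by (auto simp: algebra_simps intro!: exI[of _ n])
  qed (auto intro: order.strict_trans1[rotated])
  finally show ?thesis
    by (simp add: tail_measure_def)
qed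

text \<open>Right continuity of the distribution function means that the infimum defining f* is
  attained when finite. This equivalence turns statements about f* into statements about superlevel
  sets.\<close>

lemma rearr_le_iff:
  assumes "f \<in> borel_measurable M" "0 \<le> l"
  shows "rearr M f t \<le> ennreal l \<longleftrightarrow> tail_measure M f l \<le> ennreal t"
proof
  assume le: "rearr M f t \<le> ennreal l"
  have "tail_measure M f (l + 1 / Suc n) \<le> ennreal t" for n
  proof -
    have "rearr M f t < ennreal (l + 1 / Suc n)"
      using le assms(2) by (rule_tac order.strict_trans1) (auto simp: ennreal_less_iff)
    then obtain k where k: "0 \<le> k" "tail_measure M f k \<le> ennreal t" "k < l + 1 / Suc n"
      unfolding rearr_def Inf_less_iff tail_measure_def by (auto simp: ennreal_less_iff)
    then show ?thesis
      using tail_measure_antimono[OF assms(1), of k "l + 1 / Suc n"] by simp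
  qed
  then show "tail_measure M f l \<le> ennreal t"
    by (subst tail_measure_right_continuous[OF assms(1)]) (rule SUP_least)
next
  assume "tail_measure M f l \<le> ennreal t"
  then show "rearr M f t \<le> ennreal l"
    unfolding rearr_def tail_measure_def using assms(2) by (intro Inf_lower) auto
qed

lemma antimono_rearr: "antimono (rearr M f)"
  unfolding rearr_def
  by (intro antimonoI Inf_superset_mono) (blast intro: order_trans ennreal_leI)

lemma borel_measurable_rearr [measurable]: "rearr M f \<in> borel_measurable borel"
  by (intro borel_measurable_antimono_ennreal antimono_rearr)

lemma rearr_uminus: "rearr M (\<lambda>x. - f x) = rearr M f"
  by (simp add: rearr_def fun_eq_iff)

lemma osc_rearr_eq: "osc_rearr M f = osc (rearr M f)"
  by (simp add: osc_rearr_def avg_rearr_def osc_def mean_def fun_eq_iff)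

lemma borel_measurable_osc_rearr [measurable]: "osc_rearr M f \<in> borel_measurable borel"
  unfolding osc_rearr_eq osc_def by measurable

lemma tail_measure_add_le:
  assumes [measurable]: "f \<in> borel_measurable M" "g \<in> borel_measurable M" "h \<in> borel_measurable M"
    and ae: "AE x in M. f x = g x + h x"
  shows "tail_measure M f (k + l) \<le> tail_measure M g k + tail_measure M h l"
proof -
  have "tail_measure M f (k + l)
      \<le> emeasure M ({x \<in> space M. k < norm (g x)} \<union> {x \<in> space M. l < norm (h x)})"
    unfolding tail_measure_def
  proof (rule emeasure_mono_AE)
    show "AE x in M. x \<in> {x \<in> space M. k + l < norm (f x)} \<longrightarrow>
      x \<in> {x \<in> space M. k < norm (g x)} \<union> {x \<in> space M. l < norm (h x)}"
      using ae
    proof eventually_elim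
      fix x assume "f x = g x + h x"
      then have "norm (f x) \<le> norm (g x) + norm (h x)"
        by (simp add: norm_triangle_ineq)
      then show "x \<in> {x \<in> space M. k + l < norm (f x)} \<longrightarrow>
          x \<in> {x \<in> space M. k < norm (g x)} \<union> {x \<in> space M. l < norm (h x)}"
        by auto
    qed
  qed measurable
  also have "\<dots> \<le> tail_measure M g k + tail_measure M h l"
    unfolding tail_measure_def by (intro emeasure_subadditive) measurable
  finally show ?thesis .
qed

lemma rearr_add_le:
  assumes "f \<in> borel_measurable M" "g \<in> borel_measurable M" "h \<in> borel_measurable M"
    and "AE x in M. f x = g x + h x" and "0 \<le> s" "0 \<le> t"
  shows "rearr M f (s + t) \<le> rearr M g s + rearr M h t"
proof (cases "rearr M g s"; cases "rearr M h t")
  fix k l assume kl: "0 \<le> k" "rearr M g s = ennreal k" "0 \<le> l" "rearr M h t = ennreal l"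
  have "tail_measure M g k \<le> ennreal s" "tail_measure M h l \<le> ennreal t"
    using kl assms by (simp_all flip: rearr_le_iff)
  then have "tail_measure M f (k + l) \<le> ennreal (s + t)"
    using order_trans[OF tail_measure_add_le[OF assms(1-4)] add_mono] assms(5,6) by simp
  then show ?thesis
    using kl assms by (simp add: rearr_le_iff flip: ennreal_plus)
qed auto

text \<open>Equimeasurability: f* exceeds the level l^(1/p) exactly on the interval from 0 to the
  value of the distribution function there, so the two layer-cake integrands coincide.\<close>

lemma nn_integral_rearr:
  assumes "sigma_finite_measure M" and [measurable]: "f \<in> borel_measurable M" and "0 < p"
  shows "(\<integral>\<^sup>+s\<in>{0<..}. epowr (rearr M f s) p \<partial>lborel) = (\<integral>\<^sup>+x. ennreal (norm (f x) powr p) \<partial>M)"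
proof -
  have "emeasure lborel {s \<in> space lborel. ennreal l < epowr (rearr M f s) p * indicator {0<..} s}
      = emeasure M {x \<in> space M. ennreal l < ennreal (norm (f x) powr p)}" if l: "0 < l" for l
  proof -
    have "ennreal l < epowr (rearr M f s) p \<longleftrightarrow> ennreal s < tail_measure M f (l powr (1 / p))" for s
    proof -
      have "epowr (rearr M f s) p \<le> ennreal l \<longleftrightarrow> tail_measure M f (l powr (1 / p)) \<le> ennreal s"
        using assms l by (simp add: epowr_le_iff epowr_ennreal rearr_le_iff)
      then show ?thesis by (metis not_le)
    qed
    then have "{s \<in> space lborel. ennreal l < epowr (rearr M f s) p * indicator {0<..} s}
        = {s. 0 < s \<and> ennreal s < tail_measure M f (l powr (1 / p))}"
      using l by (auto simp: indicator_def)
    moreover have "l < norm (f x) powr p \<longleftrightarrow> l powr (1 / p) < norm (f x)" for x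
      using powr_less_mono2[of p "l powr (1 / p)" "norm (f x)"]
        powr_less_mono2[of "1 / p" l "norm (f x) powr p"] assms l
      by (auto simp: powr_powr)
    ultimately show ?thesis
      using l by (simp add: emeasure_ennreal_less tail_measure_def ennreal_less_iff)
  qed
  then have "(\<integral>\<^sup>+l\<in>{0<..}. emeasure lborel
        {s \<in> space lborel. ennreal l < epowr (rearr M f s) p * indicator {0<..} s} \<partial>lborel)
      = (\<integral>\<^sup>+l\<in>{0<..}. emeasure M {x \<in> space M. ennreal l < ennreal (norm (f x) powr p)} \<partial>lborel)"
    by (intro nn_integral_cong) (auto simp: indicator_def)
  then show ?thesis
    using nn_integral_layer_cake[OF assms(1), of "\<lambda>x. ennreal (norm (f x) powr p)"]
      nn_integral_layer_cake[of lborel "\<lambda>s. epowr (rearr M f s) p * indicator {0<..} s"]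
    by (simp add: lborel.sigma_finite_measure_axioms)
qed

section \<open>Truncation\<close>

text \<open>For l \<ge> 0, the radial projection onto the closed ball of radius l. Keeping the
  direction splits \<open>norm y\<close> exactly into its part up to l and its excess over
  l.\<close>

definition trunc :: "real \<Rightarrow> 'b::real_normed_vector \<Rightarrow> 'b" where
  "trunc l y = (if norm y \<le> l then y else (l / norm y) *\<^sub>R y)"

lemma norm_trunc: "0 \<le> l \<Longrightarrow> norm (trunc l y) = min (norm y) l"
  by (auto simp: trunc_def)

lemma norm_diff_trunc: "0 \<le> l \<Longrightarrow> norm (y - trunc l y) = max 0 (norm y - l)"
proof (cases "norm y \<le> l")
  case False
  assume l: "0 \<le> l"
  have "y - trunc l y = (1 - l / norm y) *\<^sub>R y"
    using False by (simp add: trunc_def scaleR_left_diff_distrib)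
  then have "norm (y - trunc l y) = (1 - l / norm y) * norm y"
    using False l by (simp add: divide_le_eq)
  also have "\<dots> = norm y - l"
    using False l by (cases "y = 0") (auto simp: field_simps)
  finally show ?thesis using False by simp
qed (simp add: trunc_def)

lemma borel_measurable_trunc [measurable]:
  fixes f :: "'a \<Rightarrow> 'b::{real_normed_vector, second_countable_topology}"
  assumes [measurable]: "f \<in> borel_measurable M"
  shows "(\<lambda>x. trunc l (f x)) \<in> borel_measurable M"
  unfolding trunc_def by measurable

text \<open>Truncation leaves the distribution function unchanged below l and makes it 0 from l
  on.\<close>

lemma rearr_trunc:
  fixes f :: "'a \<Rightarrow> 'b::{real_normed_vector, second_countable_topology}"
  assumes [measurable]: "f \<in> borel_measurable M" and "0 \<le> l"
  shows "rearr M (\<lambda>x. trunc l (f x)) s = min (rearr M f s) (ennreal l)"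
proof (rule ennreal_eqI_le_real)
  fix a :: real assume a: "0 \<le> a"
  have "tail_measure M (\<lambda>x. trunc l (f x)) a = (if a < l then tail_measure M f a else 0)"
    using assms by (auto simp: tail_measure_def norm_trunc intro!: arg_cong[where f="emeasure M"])
  then show "rearr M (\<lambda>x. trunc l (f x)) s \<le> ennreal a \<longleftrightarrow> min (rearr M f s) (ennreal l) \<le> ennreal a"
    using a assms by (auto simp: rearr_le_iff min_le_iff_disj)
qed

text \<open>Removing the truncation shifts the distribution function by l.\<close>

lemma rearr_diff_trunc:
  fixes f :: "'a \<Rightarrow> 'b::{real_normed_vector, second_countable_topology}"
  assumes [measurable]: "f \<in> borel_measurable M" and "0 \<le> l"
  shows "rearr M (\<lambda>x. f x - trunc l (f x)) s = rearr M f s - ennreal l"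
proof (rule ennreal_eqI_le_real)
  fix a :: real assume a: "0 \<le> a"
  have "tail_measure M (\<lambda>x. f x - trunc l (f x)) a = tail_measure M f (l + a)"
    using assms a by (auto simp: tail_measure_def norm_diff_trunc intro!: arg_cong[where f="emeasure M"])
  then show "rearr M (\<lambda>x. f x - trunc l (f x)) s \<le> ennreal a \<longleftrightarrow> rearr M f s - ennreal l \<le> ennreal a"
    using a assms by (simp add: rearr_le_iff ennreal_minus_le_iff flip: ennreal_plus)
qed

text \<open>Equimeasurability with exponent 1 for the excess f - trunc l f. On the right
  \<open>ennreal\<close> takes the positive part, so the pointwise triangle inequality becomes
  available.\<close>

lemma nn_integral_excess_rearr:
  fixes f :: "'a \<Rightarrow> 'b::{real_normed_vector, second_countable_topology}"
  assumes "sigma_finite_measure M" and [measurable]: "f \<in> borel_measurable M" and "0 \<le> l"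
  shows "(\<integral>\<^sup>+s\<in>{0<..}. (rearr M f s - ennreal l) \<partial>lborel) = (\<integral>\<^sup>+x. ennreal (norm (f x) - l) \<partial>M)"
proof -
  have "ennreal (max 0 a) = ennreal a" for a
    by (simp add: max_def ennreal_neg)
  then show ?thesis
    using nn_integral_rearr[of M "\<lambda>x. f x - trunc l (f x)" 1] assms
    by (simp add: rearr_diff_trunc norm_diff_trunc)
qed

section \<open>Rearrangements vanishing at infinity\<close>

lemma antimono_tendsto_zero_iff:
  fixes h :: "real \<Rightarrow> ennreal"
  assumes "antimono h"
  shows "(h \<longlongrightarrow> 0) at_top \<longleftrightarrow> (\<forall>e>0. \<exists>t>0. h t \<le> ennreal e)"
proof safe
  fix e :: real assume "(h \<longlongrightarrow> 0) at_top" "0 < e"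
  then have "eventually (\<lambda>t. h t < ennreal e) at_top"
    by (intro order_tendstoD) auto
  then obtain T where T: "\<And>t. T \<le> t \<Longrightarrow> h t < ennreal e"
    by (auto simp: eventually_at_top_linorder)
  then show "\<exists>t>0. h t \<le> ennreal e"
    by (intro exI[of _ "max T 1"]) (auto simp: less_imp_le)
next
  assume *: "\<forall>e>0. \<exists>t>0. h t \<le> ennreal e"
  show "(h \<longlongrightarrow> 0) at_top"
  proof (rule order_tendstoI)
    fix a :: ennreal assume "0 < a"
    then obtain b where b: "0 < b" "b < a"
      using dense by blast
    then obtain r where r: "b = ennreal r" "0 < r"
      by (cases b) (auto simp: ennreal_zero_less_top top_unique less_top[symmetric])
    then obtain T where "h T \<le> ennreal r"
      using * by blast
    then have "h t < a" if "T \<le> t" for t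
      using antimonoD[OF assms that] b r by (meson order.strict_trans1 order_trans)
    then show "eventually (\<lambda>t. h t < a) at_top"
      by (auto simp: eventually_at_top_linorder)
  qed auto
qed

text \<open>Decay of f* gives the set where the norm exceeds 1 finite measure. The superlevel sets
  at integer levels then decrease to the empty set, f being finite everywhere, and continuity from
  above makes their measure drop below t.\<close>

lemma rearr_less_top:
  assumes [measurable]: "f \<in> borel_measurable M" and "(rearr M f \<longlongrightarrow> 0) at_top" "0 < t"
  shows "rearr M f t < top"
proof -
  obtain T where "rearr M f T \<le> ennreal 1"
    using assms(2) by (auto simp: antimono_tendsto_zero_iff[OF antimono_rearr] dest: spec[of _ "1::real"])
  then have "tail_measure M f 1 \<le> ennreal T"
    by (subst (asm) rearr_le_iff) auto
  then have fin: "tail_measure M f 1 < top"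
    by (rule order.strict_trans1) simp
  define A where "A n = {x \<in> space M. real (Suc n) < norm (f x)}" for n
  have "A n \<subseteq> {x \<in> space M. 1 < norm (f x)}" for n
    by (auto simp: A_def)
  then have "emeasure M (A n) \<le> tail_measure M f 1" for n
    unfolding tail_measure_def by (intro emeasure_mono) auto
  then have "emeasure M (A n) \<noteq> \<infinity>" for n
    using fin by (metis infinity_ennreal_def leD)
  then have "(INF n. emeasure M (A n)) = emeasure M (\<Inter>n. A n)"
    by (intro INF_emeasure_decseq decseq_SucI) (auto simp: A_def)
  also have "(\<Inter>n. A n) = {}"
  proof (intro equals0I)
    fix x assume x: "x \<in> (\<Inter>n. A n)"
    obtain n where "norm (f x) < real n"
      using reals_Archimedean2 by blast
    with x show False
      by (auto simp: A_def dest!: spec[of _ n])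
  qed
  finally have "(INF n. emeasure M (A n)) < ennreal t"
    using assms by simp
  then obtain n where "emeasure M (A n) < ennreal t"
    by (auto simp: INF_less_iff)
  then have "rearr M f t \<le> ennreal (real (Suc n))"
    by (subst rearr_le_iff) (auto simp: tail_measure_def A_def)
  then show ?thesis
    by (rule order.strict_trans1) simp
qed

lemma rearr_tendsto_zero_Lp:
  fixes f :: "'a \<Rightarrow> 'b::{real_normed_vector, second_countable_topology}"
  assumes "sigma_finite_measure M" "f \<in> Lp_space M p" "0 < p"
  shows "(rearr M f \<longlongrightarrow> 0) at_top"
  unfolding antimono_tendsto_zero_iff[OF antimono_rearr]
proof safe
  fix e :: real assume e: "0 < e"
  have f [measurable]: "f \<in> borel_measurable M"
    using assms by (simp add: Lp_space_def)
  have "(\<integral>\<^sup>+s\<in>{0<..}. epowr (rearr M f s) p \<partial>lborel) < top"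
    using assms f by (simp add: nn_integral_rearr Lp_space_def Lp_norm_def)
  then obtain I where I: "0 \<le> I" "(\<integral>\<^sup>+s\<in>{0<..}. epowr (rearr M f s) p \<partial>lborel) = ennreal I"
    by (metis ennreal_cases less_irrefl)
  \<comment> \<open>Chebyshev's argument: f* > e at t would force the integral to be at least e^p *
    t = I + 1.\<close>
  define t where "t = (I + 1) / e powr p"
  have t: "0 < t" using I e by (simp add: t_def)
  have "rearr M f t \<le> ennreal e"
  proof (rule ccontr)
    assume "\<not> rearr M f t \<le> ennreal e"
    then have "ennreal (e powr p) \<le> epowr (rearr M f t) p"
      using e assms by (simp add: epowr_mono flip: epowr_ennreal)
    then have le: "ennreal (e powr p) \<le> epowr (rearr M f s) p" if "s \<le> t" for s
      using antimonoD[OF antimono_rearr that, of M f] assms by (meson epowr_mono less_imp_le order_trans)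
    have "ennreal (e powr p * t) = (\<integral>\<^sup>+s\<in>{0<..<t}. ennreal (e powr p) \<partial>lborel)"
      using t by (simp add: nn_integral_cmult_indicator ennreal_mult)
    also have "\<dots> \<le> ennreal I"
      unfolding I(2)[symmetric] by (intro nn_integral_mono) (auto simp: indicator_def le)
    finally show False
      using I e by (simp add: t_def)
  qed
  with t show "\<exists>t>0. rearr M f t \<le> ennreal e" by blast
qed

lemma rearr_tendsto_zero_add:
  assumes "f \<in> borel_measurable M" "g \<in> borel_measurable M" "h \<in> borel_measurable M"
    and "AE x in M. f x = g x + h x"
    and "(rearr M g \<longlongrightarrow> 0) at_top" "(rearr M h \<longlongrightarrow> 0) at_top"
  shows "(rearr M f \<longlongrightarrow> 0) at_top"
  unfolding antimono_tendsto_zero_iff[OF antimono_rearr]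
proof safe
  fix e :: real assume e: "0 < e"
  then obtain s t where st: "0 < s" "0 < t" "rearr M g s \<le> ennreal (e / 2)" "rearr M h t \<le> ennreal (e / 2)"
    using assms(5,6) unfolding antimono_tendsto_zero_iff[OF antimono_rearr] by (metis half_gt_zero)
  have "rearr M f (s + t) \<le> rearr M g s + rearr M h t"
    using assms(1-4) st by (intro rearr_add_le) auto
  also have "\<dots> \<le> ennreal (e / 2) + ennreal (e / 2)"
    using st by (intro add_mono) auto
  also have "\<dots> = ennreal e"
    using e by (simp flip: ennreal_plus)
  finally show "\<exists>t>0. rearr M f t \<le> ennreal e"
    using st by (intro exI[of _ "s + t"]) auto
qed

section \<open>The lower bound\<close>

text \<open>With the levels k = g*(s) and l = h*(2s), the excess of the norm of f over k + l is at
  most the sum of the excesses of g over k and of h over l. Integrated, these are s and 2s times the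
  respective oscillations.\<close>

lemma osc_rearr_add_le:
  fixes f g h :: "'a \<Rightarrow> 'b::{real_normed_vector, second_countable_topology}"
  assumes M: "sigma_finite_measure M"
    and [measurable]: "f \<in> borel_measurable M" "g \<in> borel_measurable M" "h \<in> borel_measurable M"
    and ae: "AE x in M. f x = g x + h x"
    and fin: "rearr M f s < top" "rearr M g s < top" "rearr M h (2 * s) < top" and s: "0 < s"
  shows "osc_rearr M f s \<le> 2 * (mean (rearr M g) s + osc_rearr M h (2 * s))"
proof -
  obtain k where k: "0 \<le> k" "rearr M g s = ennreal k"
    using fin(2) by (metis ennreal_cases less_irrefl)
  obtain l where l: "0 \<le> l" "rearr M h (2 * s) = ennreal l"
    using fin(3) by (metis ennreal_cases less_irrefl)
  have "ennreal s * mean (rearr M f) s = (\<integral>\<^sup>+u\<in>{0<..<s}. rearr M f u \<partial>lborel)"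
    using s by (rule mult_mean)
  \<comment> \<open>Splitting f* at height k + l and letting its excess run over the whole half-line
    turns that part into an integral over M.\<close>
  also have "\<dots> \<le> (\<integral>\<^sup>+u. ennreal (k + l) * indicator {0<..<s} u
      + (rearr M f u - ennreal (k + l)) * indicator {0<..} u \<partial>lborel)"
    by (intro nn_integral_mono) (auto simp: indicator_def add_diff_self_ennreal)
  also have "\<dots> = ennreal (k + l) * ennreal s + (\<integral>\<^sup>+x. ennreal (norm (f x) - (k + l)) \<partial>M)"
    using k l s M
    by (subst nn_integral_add)
      (simp_all add: nn_integral_cmult_indicator nn_integral_excess_rearr del: ennreal_plus)
  also have "(\<integral>\<^sup>+x. ennreal (norm (f x) - (k + l)) \<partial>M)
      \<le> (\<integral>\<^sup>+x. ennreal (norm (g x) - k) + ennreal (norm (h x) - l) \<partial>M)"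
  proof (rule nn_integral_mono_AE)
    show "AE x in M. ennreal (norm (f x) - (k + l)) \<le> ennreal (norm (g x) - k) + ennreal (norm (h x) - l)"
      using ae
    proof eventually_elim
      fix x assume "f x = g x + h x"
      then have "norm (f x) \<le> norm (g x) + norm (h x)"
        by (simp add: norm_triangle_ineq)
      then have "norm (f x) - (k + l) \<le> max 0 (norm (g x) - k) + max 0 (norm (h x) - l)"
        by linarith
      then have "ennreal (norm (f x) - (k + l)) \<le> ennreal (max 0 (norm (g x) - k)) + ennreal (max 0 (norm (h x) - l))"
        by (simp add: ennreal_leI flip: ennreal_plus)
      then show "ennreal (norm (f x) - (k + l)) \<le> ennreal (norm (g x) - k) + ennreal (norm (h x) - l)"
        by (simp add: max_def ennreal_neg split: if_splits)
    qed
  qed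
  also have "\<dots> = (\<integral>\<^sup>+u\<in>{0<..}. (rearr M g u - rearr M g s) \<partial>lborel)
      + (\<integral>\<^sup>+u\<in>{0<..}. (rearr M h u - rearr M h (2 * s)) \<partial>lborel)"
    using k l M by (simp add: nn_integral_add nn_integral_excess_rearr)
  also have "\<dots> = ennreal s * osc (rearr M g) s + ennreal (2 * s) * osc (rearr M h) (2 * s)"
    using s fin by (simp add: nn_integral_excess_eq_osc antimono_rearr)
  also have "ennreal (k + l) * ennreal s + \<dots>
      = ennreal s * (rearr M h (2 * s) + (rearr M g s + osc (rearr M g) s) + 2 * osc (rearr M h) (2 * s))"
    using k l s by (simp add: algebra_simps ennreal_mult)
  also have "rearr M g s + osc (rearr M g) s = mean (rearr M g) s"
    using s by (simp add: mean_eq_add_osc antimono_rearr)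
  finally have "mean (rearr M f) s
      \<le> rearr M h (2 * s) + mean (rearr M g) s + 2 * osc (rearr M h) (2 * s)"
    using s by (simp add: ennreal_mult_le_mult_iff add_left_mono)
  \<comment> \<open>Here h = f - g is used to trade h*(2s) for f*(s), which is then subtracted. The
    argument s + s = 2s explains the doubling in the statement.\<close>
  also have "rearr M h (2 * s) \<le> rearr M f s + rearr M g s"
  proof -
    have "AE x in M. h x = f x + - g x"
      using ae by eventually_elim simp
    then show ?thesis
      using rearr_add_le[of h M f "\<lambda>x. - g x" s s] s by (simp add: rearr_uminus)
  qed
  also have "rearr M g s \<le> mean (rearr M g) s"
    using s by (intro mean_ge) (auto intro: antimonoD[OF antimono_rearr])
  finally have "mean (rearr M f) s
      \<le> rearr M f s + 2 * (mean (rearr M g) s + osc (rearr M h) (2 * s))"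
    by (simp add: mult_2 algebra_simps)
  then show ?thesis
    unfolding osc_rearr_eq osc_def[of "rearr M f"] ennreal_minus_le_iff using fin(1) by auto
qed

text \<open>The weight w lies below min(1, (t/s)^\<alpha>), so one estimate serves both terms of the
  formula. The bound 1 sends the part of g to Hardy's inequality, the other bound sends the part of
  h to its weighted norm.\<close>

lemma nn_integral_osc_rearr_le:
  assumes M: "sigma_finite_measure M" and "1 < p"
  obtains C :: real where "0 < C"
    "\<And>(f :: 'a \<Rightarrow> 'b::{real_normed_vector, second_countable_topology}) g h t w.
      f \<in> borel_measurable M \<Longrightarrow> g \<in> Lp_space M p \<Longrightarrow> h \<in> Sp_space M p \<alpha> \<Longrightarrow>
      (AE x in M. f x = g x + h x) \<Longrightarrow> 0 < t \<Longrightarrow>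
      (\<And>s. 0 < s \<Longrightarrow> w s \<le> 1 \<and> w s \<le> ennreal (t powr \<alpha>) * ennreal (s powr -\<alpha>)) \<Longrightarrow>
      (\<integral>\<^sup>+s\<in>{0<..}. (epowr (osc_rearr M f s) p * w s) \<partial>lborel)
        \<le> ennreal C * (epowr (Lp_norm M p g) p + epowr (ennreal (t powr (\<alpha> / p)) * Sp_norm M p \<alpha> h) p)"
proof -
  obtain H where H: "0 < H"
    "\<And>h. antimono h \<Longrightarrow>
      (\<integral>\<^sup>+s\<in>{0<..}. epowr (mean h s) p \<partial>lborel) \<le> ennreal H * (\<integral>\<^sup>+s\<in>{0<..}. epowr (h s) p \<partial>lborel)"
    using hardy_antimono[OF \<open>1 < p\<close>] by blast
  \<comment> \<open>One 2^p comes from the factor 2 in the oscillation estimate, the other from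
    splitting the power of a sum; 2^\<alpha> comes from writing the weight at 2s instead of
    s.\<close>
  define C where "C = (2 powr p * 2 powr p) * (H + 2 powr \<alpha>)"
  have "0 < C" using H by (simp add: C_def add_pos_pos)
  moreover have "(\<integral>\<^sup>+s\<in>{0<..}. (epowr (osc_rearr M f s) p * w s) \<partial>lborel)
        \<le> ennreal C * (epowr (Lp_norm M p g) p + epowr (ennreal (t powr (\<alpha> / p)) * Sp_norm M p \<alpha> h) p)"
    if f [measurable]: "f \<in> borel_measurable M" and g: "g \<in> Lp_space M p" and h: "h \<in> Sp_space M p \<alpha>"
      and ae: "AE x in M. f x = g x + h x" and t: "0 < t"
      and w: "\<And>s. 0 < s \<Longrightarrow> w s \<le> 1 \<and> w s \<le> ennreal (t powr \<alpha>) * ennreal (s powr -\<alpha>)"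
    for f g h :: "'a \<Rightarrow> 'b" and t w
  proof -
    have [measurable]: "g \<in> borel_measurable M" "h \<in> borel_measurable M"
      using g h by (auto simp: Lp_space_def Sp_space_def)
    have g0: "(rearr M g \<longlongrightarrow> 0) at_top"
      using M g assms by (intro rearr_tendsto_zero_Lp) auto
    have h0: "(rearr M h \<longlongrightarrow> 0) at_top"
      using h by (simp add: Sp_space_def)
    have f0: "(rearr M f \<longlongrightarrow> 0) at_top"
      using ae g0 h0 by (intro rearr_tendsto_zero_add[of f M g h]) auto
    define v where "v s = epowr (osc_rearr M h s) p * ennreal (s powr -\<alpha>) * indicator {0<..} s" for s
    have [measurable]: "v \<in> borel_measurable borel"
      unfolding v_def by measurable
    let ?D = "ennreal (2 powr p * 2 powr p)"
    have pt: "epowr (osc_rearr M f s) p * w s * indicator {0<..} s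
        \<le> ?D * (epowr (mean (rearr M g) s) p * indicator {0<..} s + ennreal (t powr \<alpha> * 2 powr \<alpha>) * v (2 * s))"
      for s
    proof (cases "0 < s")
      case s: True
      let ?m = "epowr (mean (rearr M g) s) p" and ?o = "epowr (osc_rearr M h (2 * s)) p"
      have "epowr (osc_rearr M f s) p \<le> epowr (ennreal 2 * (mean (rearr M g) s + osc_rearr M h (2 * s))) p"
        using osc_rearr_add_le[OF M _ _ _ ae, of s] s f0 g0 h0 assms
        by (intro epowr_mono) (auto simp: rearr_less_top)
      also have "\<dots> = ennreal (2 powr p) * epowr (mean (rearr M g) s + osc_rearr M h (2 * s)) p"
        using assms by (simp only: epowr_mult epowr_ennreal)
      also have "\<dots> \<le> ennreal (2 powr p) * (ennreal (2 powr p) * (?m + ?o))"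
        using assms by (intro mult_left_mono epowr_add_le) auto
      also have "\<dots> = ?D * (?m + ?o)"
        by (simp add: ennreal_mult mult.assoc)
      finally have "epowr (osc_rearr M f s) p * w s \<le> ?D * (?m + ?o) * w s"
        by (intro mult_right_mono) auto
      also have "\<dots> = ?D * (?m * w s + ?o * w s)"
        by (simp add: algebra_simps)
      also have "\<dots> \<le> ?D * (?m * 1 + ?o * (ennreal (t powr \<alpha>) * ennreal (s powr -\<alpha>)))"
        using w[OF s] by (intro mult_left_mono add_mono) auto
      also have "ennreal (s powr -\<alpha>) = ennreal (2 powr \<alpha>) * ennreal ((2 * s) powr -\<alpha>)"
        using s by (simp add: powr_mult powr_minus flip: ennreal_mult)
      finally show ?thesis
        using s by (simp add: v_def ennreal_mult mult_ac)
    qed auto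
    have "(\<integral>\<^sup>+s\<in>{0<..}. (epowr (osc_rearr M f s) p * w s) \<partial>lborel)
        \<le> (\<integral>\<^sup>+s. ?D * (epowr (mean (rearr M g) s) p * indicator {0<..} s
            + ennreal (t powr \<alpha> * 2 powr \<alpha>) * v (2 * s)) \<partial>lborel)"
      by (intro nn_integral_mono pt)
    also have "\<dots> = ?D * ((\<integral>\<^sup>+s\<in>{0<..}. epowr (mean (rearr M g) s) p \<partial>lborel)
            + ennreal (t powr \<alpha> * 2 powr \<alpha>) * (\<integral>\<^sup>+s. v (2 * s) \<partial>lborel))"
      by (simp add: nn_integral_cmult nn_integral_add)
    also have "\<dots> \<le> ?D * (ennreal H * epowr (Lp_norm M p g) p
            + ennreal (t powr \<alpha> * 2 powr \<alpha>) * epowr (Sp_norm M p \<alpha> h) p)"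
    proof (intro mult_left_mono add_mono)
      show "(\<integral>\<^sup>+s\<in>{0<..}. epowr (mean (rearr M g) s) p \<partial>lborel) \<le> ennreal H * epowr (Lp_norm M p g) p"
        using H(2)[OF antimono_rearr, of M g] M assms by (simp add: nn_integral_rearr Lp_norm_def)
      have "(\<integral>\<^sup>+s. v (2 * s) \<partial>lborel) = ennreal (1 / 2) * (\<integral>\<^sup>+s. v s \<partial>lborel)"
        by (rule nn_integral_dilation) auto
      also have "\<dots> \<le> 1 * (\<integral>\<^sup>+s. v s \<partial>lborel)"
        by (intro mult_right_mono) (simp_all only: ennreal_le_1, simp_all)
      also have "\<dots> = epowr (Sp_norm M p \<alpha> h) p"
        using assms by (simp add: Sp_norm_def v_def)
      finally show "(\<integral>\<^sup>+s. v (2 * s) \<partial>lborel) \<le> epowr (Sp_norm M p \<alpha> h) p" .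
    qed auto
    also have "\<dots> = ?D * (ennreal H * epowr (Lp_norm M p g) p
            + ennreal (2 powr \<alpha>) * epowr (ennreal (t powr (\<alpha> / p)) * Sp_norm M p \<alpha> h) p)"
      using assms t by (simp add: epowr_mult epowr_ennreal powr_powr ennreal_mult mult_ac)
    also have "\<dots> \<le> ?D * (ennreal (H + 2 powr \<alpha>) * epowr (Lp_norm M p g) p
            + ennreal (H + 2 powr \<alpha>) * epowr (ennreal (t powr (\<alpha> / p)) * Sp_norm M p \<alpha> h) p)"
      using H(1) by (intro mult_left_mono add_mono mult_right_mono ennreal_leI) auto
    also have "\<dots> = ennreal C * (epowr (Lp_norm M p g) p + epowr (ennreal (t powr (\<alpha> / p)) * Sp_norm M p \<alpha> h) p)"
      using H(1) by (subst C_def, subst ennreal_mult'') (auto simp: distrib_left mult.assoc simp del: ennreal_plus)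
    finally show ?thesis .
  qed
  ultimately show ?thesis using that by blast
qed

section \<open>The upper bound\<close>

text \<open>The truncated rearrangement is min(f*, f*(t)). It is constant on (0, t]; for s > t it
  has the same value as f* at s and is nowhere larger, so its mean excess over that value is no
  larger either.\<close>

lemma osc_rearr_trunc_le:
  fixes f :: "'a \<Rightarrow> 'b::{real_normed_vector, second_countable_topology}"
  assumes [measurable]: "f \<in> borel_measurable M" and fin: "\<And>s. 0 < s \<Longrightarrow> rearr M f s < top"
    and t: "0 < t" and l: "0 \<le> l" "rearr M f t = ennreal l" and s: "0 < s"
  shows "osc_rearr M (\<lambda>x. trunc l (f x)) s \<le> (if s \<le> t then 0 else osc_rearr M f s)"
proof -
  let ?k = "rearr M (\<lambda>x. trunc l (f x))"
  have k: "?k u = min (rearr M f u) (rearr M f t)" for u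
    using l by (simp add: rearr_trunc)
  have "?k s < top"
    using fin[OF s] by (simp add: k min_less_iff_disj)
  then have osc: "osc_rearr M (\<lambda>x. trunc l (f x)) s = mean (\<lambda>u. ?k u - ?k s) s"
    using s by (simp add: osc_rearr_eq osc_eq_mean antimono_rearr)
  show ?thesis
  proof (cases "s \<le> t")
    case True
    have "rearr M f t \<le> rearr M f u" if "u \<le> s" for u
      using that True by (intro antimonoD[OF antimono_rearr]) simp
    then have "?k u = rearr M f t" if "u \<le> s" for u
      using that by (simp add: k)
    then have "mean (\<lambda>u. ?k u - ?k s) s \<le> 0"
      using s fin[OF t] by (intro mean_le) auto
    then show ?thesis
      using True by (simp add: osc)
  next
    case False
    then have ks: "?k s = rearr M f s"
      using antimonoD[OF antimono_rearr, of t s M f] by (simp add: k min_def)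
    have "mean (\<lambda>u. ?k u - ?k s) s \<le> mean (\<lambda>u. rearr M f u - rearr M f s) s"
      unfolding mean_def ks
      by (intro divide_right_mono_ennreal nn_integral_mono mult_right_mono ennreal_minus_mono)
        (auto simp: k)
    then show ?thesis
      using False s fin[OF s] osc by (simp add: osc_rearr_eq osc_eq_mean[OF antimono_rearr])
  qed
qed

text \<open>The level of truncation is f*(t); g is the excess and h the truncation. Membership of g
  and h in the two spaces is not asserted, because the right-hand sides may be infinite.\<close>

lemma ex_decomposition:
  assumes M: "sigma_finite_measure M" and p: "0 < p"
  obtains C :: real where "0 < C"
    "\<And>(f :: 'a \<Rightarrow> 'b::{real_normed_vector, second_countable_topology}) t.
      f \<in> borel_measurable M \<Longrightarrow> (rearr M f \<longlongrightarrow> 0) at_top \<Longrightarrow> 0 < t \<Longrightarrow>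
      \<exists>g h. g \<in> borel_measurable M \<and> h \<in> borel_measurable M \<and> (\<forall>x. f x = g x + h x) \<and>
        (rearr M h \<longlongrightarrow> 0) at_top \<and>
        epowr (Lp_norm M p g) p \<le> ennreal C * (\<integral>\<^sup>+s\<in>{0<..<2 * t}. epowr (osc_rearr M f s) p \<partial>lborel) \<and>
        epowr (Sp_norm M p \<alpha> h) p
          \<le> (\<integral>\<^sup>+s\<in>{t<..}. (epowr (osc_rearr M f s) p * ennreal (s powr -\<alpha>)) \<partial>lborel)"
proof -
  obtain C where C: "0 < C"
    "\<And>h t. antimono h \<Longrightarrow> (\<And>s. 0 < s \<Longrightarrow> h s < top) \<Longrightarrow> 0 < t \<Longrightarrow>
      (\<integral>\<^sup>+s\<in>{0<..}. epowr (h s - h t) p \<partial>lborel)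
        \<le> ennreal C * (\<integral>\<^sup>+s\<in>{0<..<2 * t}. epowr (osc h s) p \<partial>lborel)"
    using nn_integral_excess_powr_le[OF p] by blast
  have "\<exists>g h. g \<in> borel_measurable M \<and> h \<in> borel_measurable M \<and> (\<forall>x. f x = g x + h x) \<and>
        (rearr M h \<longlongrightarrow> 0) at_top \<and>
        epowr (Lp_norm M p g) p \<le> ennreal C * (\<integral>\<^sup>+s\<in>{0<..<2 * t}. epowr (osc_rearr M f s) p \<partial>lborel) \<and>
        epowr (Sp_norm M p \<alpha> h) p
          \<le> (\<integral>\<^sup>+s\<in>{t<..}. (epowr (osc_rearr M f s) p * ennreal (s powr -\<alpha>)) \<partial>lborel)"
    if f [measurable]: "f \<in> borel_measurable M" and f0: "(rearr M f \<longlongrightarrow> 0) at_top" and t: "0 < t"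
    for f :: "'a \<Rightarrow> 'b" and t
  proof -
    have fin: "rearr M f s < top" if "0 < s" for s
      using f f0 that by (rule rearr_less_top)
    obtain l where l: "0 \<le> l" "rearr M f t = ennreal l"
      using fin[OF t] by (metis ennreal_cases less_irrefl)
    define h where "h x = trunc l (f x)" for x
    define g where "g x = f x - h x" for x
    have [measurable]: "g \<in> borel_measurable M" "h \<in> borel_measurable M"
      unfolding g_def h_def by measurable
    have "epowr (Lp_norm M p g) p = (\<integral>\<^sup>+s\<in>{0<..}. epowr (rearr M g s) p \<partial>lborel)"
      using M p by (simp add: Lp_norm_def nn_integral_rearr)
    also have "\<dots> = (\<integral>\<^sup>+s\<in>{0<..}. epowr (rearr M f s - rearr M f t) p \<partial>lborel)"
      using l by (simp add: g_def[abs_def] h_def rearr_diff_trunc)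
    also have "\<dots> \<le> ennreal C * (\<integral>\<^sup>+s\<in>{0<..<2 * t}. epowr (osc_rearr M f s) p \<partial>lborel)"
      using C(2)[OF antimono_rearr fin t] by (simp add: osc_rearr_eq)
    finally have Lp: "epowr (Lp_norm M p g) p
        \<le> ennreal C * (\<integral>\<^sup>+s\<in>{0<..<2 * t}. epowr (osc_rearr M f s) p \<partial>lborel)" .
    have "epowr (Sp_norm M p \<alpha> h) p
        = (\<integral>\<^sup>+s\<in>{0<..}. (epowr (osc_rearr M h s) p * ennreal (s powr -\<alpha>)) \<partial>lborel)"
      using p by (simp add: Sp_norm_def)
    also have "\<dots> \<le> (\<integral>\<^sup>+s\<in>{t<..}. (epowr (osc_rearr M f s) p * ennreal (s powr -\<alpha>)) \<partial>lborel)"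
    proof (rule nn_integral_mono)
      fix s :: real
      show "epowr (osc_rearr M h s) p * ennreal (s powr -\<alpha>) * indicator {0<..} s
          \<le> epowr (osc_rearr M f s) p * ennreal (s powr -\<alpha>) * indicator {t<..} s"
      proof (cases "0 < s")
        case True
        then have "osc_rearr M h s \<le> (if s \<le> t then 0 else osc_rearr M f s)"
          unfolding h_def using f fin t l by (intro osc_rearr_trunc_le) auto
        then show ?thesis
          using True p by (auto simp: indicator_def intro!: mult_right_mono epowr_mono split: if_splits)
      qed auto
    qed
    finally have Sp: "epowr (Sp_norm M p \<alpha> h) p
        \<le> (\<integral>\<^sup>+s\<in>{t<..}. (epowr (osc_rearr M f s) p * ennreal (s powr -\<alpha>)) \<partial>lborel)" .
    have "rearr M h s \<le> rearr M f s" for s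
      using l by (simp add: h_def[abs_def] rearr_trunc)
    then have "(rearr M h \<longlongrightarrow> 0) at_top"
      by (intro tendsto_sandwich[OF _ _ tendsto_const f0] always_eventually) auto
    with Lp Sp show ?thesis
      by (intro exI[of _ g] exI[of _ h]) (auto simp: g_def)
  qed
  with C(1) show ?thesis using that by blast
qed

section \<open>Two-sided estimate of the K-functional\<close>

lemma le_const_mult_Inf_ennreal:
  fixes R :: ennreal
  assumes "0 < c" "\<And>x. x \<in> A \<Longrightarrow> R \<le> ennreal c * x"
  shows "R \<le> ennreal c * Inf A"
proof -
  have cc: "ennreal c * (ennreal (1 / c) * y) = y" "ennreal (1 / c) * (ennreal c * y) = y" for y
    using assms(1) by (simp_all flip: mult.assoc ennreal_mult)
  have "ennreal (1 / c) * R \<le> Inf A"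
  proof (rule Inf_greatest)
    fix x assume "x \<in> A"
    then have "ennreal (1 / c) * R \<le> ennreal (1 / c) * (ennreal c * x)"
      by (intro mult_left_mono assms) auto
    then show "ennreal (1 / c) * R \<le> x" by (simp only: cc)
  qed
  then have "ennreal c * (ennreal (1 / c) * R) \<le> ennreal c * Inf A"
    by (rule mult_left_mono) simp
  then show ?thesis by (simp only: cc)
qed

theorem corollary1p5:
  fixes M :: "'a measure" and p \<alpha> :: real
  assumes "sigma_finite_measure M"
    and "nonatomic M"
    and "emeasure M (space M) > 0"
    and "1 < p"
    and "0 < \<alpha>"
  shows "\<exists>c1 c2 :: real. c1 > 0 \<and> c2 > 0 \<and>
    (\<forall>f :: 'a \<Rightarrow> 'b::{real_normed_field, second_countable_topology}.
      f \<in> sum_space M (Lp_space M p) (Sp_space M p \<alpha>) \<longrightarrow>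
      (\<forall>t>0.
        let K = K_functional M (Lp_space M p) (Lp_norm M p) (Sp_space M p \<alpha>) (Sp_norm M p \<alpha>)
                  f (t powr (\<alpha> / p));
            R = epowr (\<integral>\<^sup>+ s\<in>{0<..<t}. epowr (osc_rearr M f s) p \<partial>lborel) (1 / p)
              + ennreal (t powr (\<alpha> / p)) *
                epowr (\<integral>\<^sup>+ s\<in>{t<..}. (epowr (osc_rearr M f s) p * ennreal (s powr (-\<alpha>))) \<partial>lborel)
                  (1 / p)
        in K \<le> ennreal c1 * R \<and> R \<le> ennreal c2 * K))"
proof -
  have M: "sigma_finite_measure M" and p: "0 < p" "0 < 1 / p" using assms by auto
  obtain C where C: "0 < C"
    "\<And>(f :: 'a \<Rightarrow> 'b) g h t w.
      f \<in> borel_measurable M \<Longrightarrow> g \<in> Lp_space M p \<Longrightarrow> h \<in> Sp_space M p \<alpha> \<Longrightarrow>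
      (AE x in M. f x = g x + h x) \<Longrightarrow> 0 < t \<Longrightarrow>
      (\<And>s. 0 < s \<Longrightarrow> w s \<le> 1 \<and> w s \<le> ennreal (t powr \<alpha>) * ennreal (s powr -\<alpha>)) \<Longrightarrow>
      (\<integral>\<^sup>+s\<in>{0<..}. (epowr (osc_rearr M f s) p * w s) \<partial>lborel)
        \<le> ennreal C * (epowr (Lp_norm M p g) p + epowr (ennreal (t powr (\<alpha> / p)) * Sp_norm M p \<alpha> h) p)"
    using nn_integral_osc_rearr_le[OF M \<open>1 < p\<close>, of \<alpha>] by blast
  obtain D where D: "0 < D"
    "\<And>(f :: 'a \<Rightarrow> 'b) t.
      f \<in> borel_measurable M \<Longrightarrow> (rearr M f \<longlongrightarrow> 0) at_top \<Longrightarrow> 0 < t \<Longrightarrow>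
      \<exists>g h. g \<in> borel_measurable M \<and> h \<in> borel_measurable M \<and> (\<forall>x. f x = g x + h x) \<and>
        (rearr M h \<longlongrightarrow> 0) at_top \<and>
        epowr (Lp_norm M p g) p \<le> ennreal D * (\<integral>\<^sup>+s\<in>{0<..<2 * t}. epowr (osc_rearr M f s) p \<partial>lborel) \<and>
        epowr (Sp_norm M p \<alpha> h) p
          \<le> (\<integral>\<^sup>+s\<in>{t<..}. (epowr (osc_rearr M f s) p * ennreal (s powr -\<alpha>)) \<partial>lborel)"
    using ex_decomposition[OF M \<open>0 < p\<close>, of \<alpha>] by blast
  \<comment> \<open>In both constants 2^(1/p) is the price of splitting a 1/p-th power of a sum. In
    E the factor 2^\<alpha> comes from comparing the weight with its value at 2t on (t, 2t).\<close>
  define B where "B = (2 * C) powr (1 / p)"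
  define E where "E = (D * 2 powr \<alpha>) powr (1 / p) * 2 powr (1 / p)"
  have B: "0 < B" and E: "0 < E" using C D by (auto simp: B_def E_def)
  show ?thesis
  \<comment> \<open>E accounts for the norm of g and 1 for that of h; 2 * B adds B for each of the
    two terms of R.\<close>
  proof (rule exI[of _ "E + 1"], rule exI[of _ "2 * B"], intro conjI allI impI)
    show "0 < E + 1" "0 < 2 * B" using B E by auto
    fix f :: "'a \<Rightarrow> 'b" and t :: real
    assume f: "f \<in> sum_space M (Lp_space M p) (Sp_space M p \<alpha>)" and t: "0 < t"
    have fm [measurable]: "f \<in> borel_measurable M"
      using f by (simp add: sum_space_def)
    obtain f0 f1 where f01: "f0 \<in> Lp_space M p" "f1 \<in> Sp_space M p \<alpha>" "AE x in M. f x = f0 x + f1 x"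
      using f by (auto simp: sum_space_def)
    have f0: "(rearr M f \<longlongrightarrow> 0) at_top"
      using f01 rearr_tendsto_zero_Lp[OF M f01(1) p(1)]
      by (intro rearr_tendsto_zero_add[of f M f0 f1]) (auto simp: Lp_space_def Sp_space_def)
    define \<tau> where "\<tau> = t powr (\<alpha> / p)"
    have \<tau>: "0 < \<tau>" "epowr (ennreal \<tau>) p = ennreal (t powr \<alpha>)"
      using t p by (auto simp: \<tau>_def epowr_ennreal powr_powr)
    define X where "X = (\<integral>\<^sup>+ s\<in>{0<..<t}. epowr (osc_rearr M f s) p \<partial>lborel)"
    define Y where "Y = (\<integral>\<^sup>+ s\<in>{t<..}. (epowr (osc_rearr M f s) p * ennreal (s powr -\<alpha>)) \<partial>lborel)"
    define R where "R = epowr X (1 / p) + ennreal \<tau> * epowr Y (1 / p)"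
    define K where "K = K_functional M (Lp_space M p) (Lp_norm M p) (Sp_space M p \<alpha>) (Sp_norm M p \<alpha>) f \<tau>"
    have \<tau>Y: "ennreal \<tau> * epowr Y (1 / p) = epowr (ennreal (t powr \<alpha>) * Y) (1 / p)"
      using p by (simp add: epowr_mult flip: \<tau>(2))

    \<comment> \<open>Lower bound of the K-functional\<close>
    have "R \<le> ennreal (2 * B) * K"
      unfolding K_def K_functional_def
    proof (rule le_const_mult_Inf_ennreal)
      show "0 < 2 * B" using B by simp
      fix x assume "x \<in> {Lp_norm M p g + ennreal \<tau> * Sp_norm M p \<alpha> h |g h.
        g \<in> Lp_space M p \<and> h \<in> Sp_space M p \<alpha> \<and> (AE x in M. f x = g x + h x)}"
      then obtain g h where x: "x = Lp_norm M p g + ennreal \<tau> * Sp_norm M p \<alpha> h"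
        and gh: "g \<in> Lp_space M p" "h \<in> Sp_space M p \<alpha>" "AE x in M. f x = g x + h x"
        by blast
      let ?N = "epowr (Lp_norm M p g) p + epowr (ennreal \<tau> * Sp_norm M p \<alpha> h) p"
      have bound: "epowr Z (1 / p) \<le> ennreal B * x" if "Z \<le> ennreal C * ?N" for Z
      proof -
        have "epowr Z (1 / p) \<le> epowr (ennreal C * ?N) (1 / p)"
          using that p by (intro epowr_mono) auto
        also have "\<dots> = ennreal (C powr (1 / p)) * epowr ?N (1 / p)"
          using p C by (simp only: epowr_mult epowr_ennreal less_imp_le)
        also have "\<dots> \<le> ennreal (C powr (1 / p)) * (ennreal (2 powr (1 / p)) * x)"
          using epowr_add_le[OF p(2), of "epowr (Lp_norm M p g) p" "epowr (ennreal \<tau> * Sp_norm M p \<alpha> h) p"] p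
          by (intro mult_left_mono) (auto simp: x)
        also have "\<dots> = ennreal B * x"
          using C by (simp add: B_def powr_mult ennreal_mult mult_ac)
        finally show ?thesis .
      qed
      \<comment> \<open>Weight: the indicator of (0, t), where (t/s)^\<alpha> \<ge> 1.\<close>
      have "X = (\<integral>\<^sup>+s\<in>{0<..}. (epowr (osc_rearr M f s) p * indicator {0<..<t} s) \<partial>lborel)"
        unfolding X_def by (intro nn_integral_cong) (auto simp: indicator_def)
      also have "\<dots> \<le> ennreal C * ?N"
        unfolding \<tau>_def
      proof (rule C(2)[OF fm gh t])
        fix s :: real assume s: "0 < s"
        have "1 \<le> t powr \<alpha> * s powr -\<alpha>" if "s < t"
          using s t that \<open>0 < \<alpha>\<close> powr_mono2[of \<alpha> s t] by (simp add: powr_minus field_simps)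
        then have "1 \<le> ennreal (t powr \<alpha>) * ennreal (s powr -\<alpha>)" if "s < t"
          using that by (simp flip: ennreal_mult)
        then show "indicator {0<..<t} s \<le> (1::ennreal) \<and>
            indicator {0<..<t} s \<le> ennreal (t powr \<alpha>) * ennreal (s powr -\<alpha>)"
          by (auto simp: indicator_def)
      qed
      finally have X: "epowr X (1 / p) \<le> ennreal B * x" by (rule bound)
      \<comment> \<open>Weight: (t/s)^\<alpha> restricted to (t, \<infinity>), where it is at most
        1.\<close>
      have "ennreal (t powr \<alpha>) * Y = (\<integral>\<^sup>+s. ennreal (t powr \<alpha>) *
          (epowr (osc_rearr M f s) p * ennreal (s powr -\<alpha>) * indicator {t<..} s) \<partial>lborel)"
        unfolding Y_def by (simp add: nn_integral_cmult)
      also have "\<dots> = (\<integral>\<^sup>+s\<in>{0<..}. (epowr (osc_rearr M f s) p *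
          (ennreal (t powr \<alpha>) * ennreal (s powr -\<alpha>) * indicator {t<..} s)) \<partial>lborel)"
        using t by (intro nn_integral_cong) (auto simp: indicator_def mult_ac)
      also have "\<dots> \<le> ennreal C * ?N"
        unfolding \<tau>_def
      proof (rule C(2)[OF fm gh t])
        fix s :: real assume s: "0 < s"
        have "t powr \<alpha> * s powr -\<alpha> \<le> 1" if "t < s"
          using s t that \<open>0 < \<alpha>\<close> powr_mono2[of \<alpha> t s] by (simp add: powr_minus field_simps)
        then have "ennreal (t powr \<alpha>) * ennreal (s powr -\<alpha>) \<le> 1" if "t < s"
          using that by (simp flip: ennreal_mult)
        then show "ennreal (t powr \<alpha>) * ennreal (s powr -\<alpha>) * indicator {t<..} s \<le> (1::ennreal) \<and>
            ennreal (t powr \<alpha>) * ennreal (s powr -\<alpha>) * indicator {t<..} s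
              \<le> ennreal (t powr \<alpha>) * ennreal (s powr -\<alpha>)"
          by (auto simp: indicator_def)
      qed
      finally have Y: "ennreal \<tau> * epowr Y (1 / p) \<le> ennreal B * x"
        unfolding \<tau>Y by (rule bound)
      have "R \<le> ennreal B * x + ennreal B * x"
        unfolding R_def by (intro add_mono X Y)
      also have "\<dots> = ennreal (2 * B) * x"
        using B by (simp add: ennreal_mult mult.assoc flip: mult_2)
      finally show "R \<le> ennreal (2 * B) * x" .
    qed

    \<comment> \<open>Upper bound of the K-functional\<close>
    moreover have "K \<le> ennreal (E + 1) * R"
    \<comment> \<open>Finiteness of R is what places the constructed g and h in the two spaces; for
      infinite R the bound is trivial.\<close>
    proof (cases "R < top")
      case True
      then have XY: "X < top" "Y < top"
        using \<tau> by (auto simp: R_def ennreal_mult_less_top less_top ennreal_mult_eq_top_iff epowr_def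
            split: if_splits)
      obtain g h where gh: "g \<in> borel_measurable M" "h \<in> borel_measurable M" "\<And>x. f x = g x + h x"
        "(rearr M h \<longlongrightarrow> 0) at_top"
        "epowr (Lp_norm M p g) p \<le> ennreal D * (\<integral>\<^sup>+s\<in>{0<..<2 * t}. epowr (osc_rearr M f s) p \<partial>lborel)"
        "epowr (Sp_norm M p \<alpha> h) p \<le> Y"
        using D(2)[OF fm f0 t] unfolding Y_def by blast
      let ?Z = "ennreal (t powr \<alpha>) * Y"
      \<comment> \<open>The decomposition needs the oscillation up to 2t, but X stops at t. On (t,
        2t) the factor (2t/s)^\<alpha> is at least 1, so the surplus is controlled by Y; the point s
        = t, in neither range, is null.\<close>
      have "(\<integral>\<^sup>+s\<in>{0<..<2 * t}. epowr (osc_rearr M f s) p \<partial>lborel)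
          \<le> (\<integral>\<^sup>+s. epowr (osc_rearr M f s) p * indicator {0<..<t} s + ennreal ((2 * t) powr \<alpha>) *
              (epowr (osc_rearr M f s) p * ennreal (s powr -\<alpha>) * indicator {t<..} s) \<partial>lborel)"
      proof (rule nn_integral_mono_AE)
        show "AE s in lborel. epowr (osc_rearr M f s) p * indicator {0<..<2 * t} s
            \<le> epowr (osc_rearr M f s) p * indicator {0<..<t} s + ennreal ((2 * t) powr \<alpha>) *
              (epowr (osc_rearr M f s) p * ennreal (s powr -\<alpha>) * indicator {t<..} s)"
          using AE_lborel_singleton[of t]
        proof eventually_elim
          fix s assume s: "s \<noteq> t"
          have "1 \<le> (2 * t) powr \<alpha> * s powr -\<alpha>" if "t < s" "s < 2 * t"
            using t that \<open>0 < \<alpha>\<close> powr_mono2[of \<alpha> s "2 * t"] by (simp add: powr_minus field_simps)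
          then have "1 \<le> ennreal ((2 * t) powr \<alpha>) * ennreal (s powr -\<alpha>)" if "t < s" "s < 2 * t"
            using that by (simp flip: ennreal_mult)
          then have "epowr (osc_rearr M f s) p * 1
              \<le> epowr (osc_rearr M f s) p * (ennreal ((2 * t) powr \<alpha>) * ennreal (s powr -\<alpha>))"
            if "t < s" "s < 2 * t"
            using that by (intro mult_left_mono) auto
          then show "epowr (osc_rearr M f s) p * indicator {0<..<2 * t} s
            \<le> epowr (osc_rearr M f s) p * indicator {0<..<t} s + ennreal ((2 * t) powr \<alpha>) *
              (epowr (osc_rearr M f s) p * ennreal (s powr -\<alpha>) * indicator {t<..} s)"
            using s by (auto simp: indicator_def mult_ac)
        qed
      qed
      also have "\<dots> = X + ennreal ((2 * t) powr \<alpha>) * Y"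
        unfolding X_def Y_def by (simp add: nn_integral_add nn_integral_cmult)
      also have "ennreal ((2 * t) powr \<alpha>) * Y = ennreal (2 powr \<alpha>) * ?Z"
        using t by (simp add: powr_mult ennreal_mult mult.assoc)
      \<comment> \<open>Since 2^\<alpha> \<ge> 1, X can be enlarged so that both terms share the
        factor 2^\<alpha>.\<close>
      also have "X + ennreal (2 powr \<alpha>) * ?Z \<le> ennreal (2 powr \<alpha>) * X + ennreal (2 powr \<alpha>) * ?Z"
        using \<open>0 < \<alpha>\<close> mult_right_mono[of 1 "ennreal (2 powr \<alpha>)" X]
        by (intro add_right_mono) (simp add: ge_one_powr_ge_zero)
      finally have "epowr (Lp_norm M p g) p \<le> ennreal D * (ennreal (2 powr \<alpha>) * X + ennreal (2 powr \<alpha>) * ?Z)"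
        using order_trans[OF gh(5) mult_left_mono] by simp
      also have "\<dots> = ennreal (D * 2 powr \<alpha>) * (X + ?Z)"
        using D(1) by (simp add: ennreal_mult algebra_simps)
      finally have "Lp_norm M p g \<le> epowr (ennreal (D * 2 powr \<alpha>) * (X + ?Z)) (1 / p)"
        using p by (simp add: epowr_le_iff)
      also have "\<dots> = ennreal ((D * 2 powr \<alpha>) powr (1 / p)) * epowr (X + ?Z) (1 / p)"
        using p D(1) by (subst epowr_mult, simp, subst epowr_ennreal) auto
      also have "\<dots> \<le> ennreal ((D * 2 powr \<alpha>) powr (1 / p)) * (ennreal (2 powr (1 / p)) * R)"
        using epowr_add_le[OF p(2), of X ?Z] by (intro mult_left_mono) (auto simp: R_def \<tau>Y)
      also have "\<dots> = ennreal E * R"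
        by (simp add: E_def ennreal_mult mult.assoc)
      finally have g: "Lp_norm M p g \<le> ennreal E * R" .
      have h: "Sp_norm M p \<alpha> h \<le> epowr Y (1 / p)"
        using gh(6) p by (simp add: epowr_le_iff)
      have "g \<in> Lp_space M p"
        using gh(1) order.strict_trans1[OF g] True by (simp add: Lp_space_def ennreal_mult_less_top)
      moreover have "h \<in> Sp_space M p \<alpha>"
        using gh(2,4) order.strict_trans1[OF h] XY by (simp add: Sp_space_def)
      ultimately have "K \<le> Lp_norm M p g + ennreal \<tau> * Sp_norm M p \<alpha> h"
        unfolding K_def K_functional_def using gh(3) by (intro Inf_lower) blast
      also have "\<dots> \<le> ennreal E * R + ennreal \<tau> * epowr Y (1 / p)"
        by (intro add_mono g mult_left_mono h) simp
      also have "\<dots> \<le> ennreal E * R + R"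
        unfolding R_def by (intro add_left_mono) simp
      also have "\<dots> = ennreal (E + 1) * R"
        using E by (simp add: distrib_right)
      finally show ?thesis .
    next
      case False
      then have "ennreal (E + 1) * R = top"
        using E by (simp add: ennreal_mult_eq_top_iff not_less top_unique)
      then show ?thesis by simp
    qed
    ultimately show "let K = K_functional M (Lp_space M p) (Lp_norm M p) (Sp_space M p \<alpha>) (Sp_norm M p \<alpha>)
                  f (t powr (\<alpha> / p));
            R = epowr (\<integral>\<^sup>+ s\<in>{0<..<t}. epowr (osc_rearr M f s) p \<partial>lborel) (1 / p)
              + ennreal (t powr (\<alpha> / p)) *
                epowr (\<integral>\<^sup>+ s\<in>{t<..}. (epowr (osc_rearr M f s) p * ennreal (s powr (-\<alpha>))) \<partial>lborel)
                  (1 / p)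
        in K \<le> ennreal (E + 1) * R \<and> R \<le> ennreal (2 * B) * K"
      unfolding Let_def K_def R_def X_def Y_def \<tau>_def by simp
  qed
qed

end
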